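(* Let $\mathbf b\in\mathcal B_k$. Then the element $x^{\mathbf b}\in\mathcal W'_k$ satisfies a linear differential equation over $\mathbb C(\lambda)$ (with $\partial_\lambda$ acting as $D_\lambda$) whose complete set of solutions is given by the nonzero series among $G^{(\mathbf b')}_{\mathbf b}(\lambda)$, $\mathbf b'\in\mathcal B_k$.
   Context: Let $A=\{\mathbf a_1,\dots,\mathbf a_m\}\subseteq\mathbb Z^n$ be linearly independent over $\mathbb R$, $\mathbf a_0\in\mathbb Z^n$, and $\ell_0,\dots,\ell_m$ positive integers with gcd $1$, $\ell_0\mathbf a_0=\sum_{j=1}^m\ell_j\mathbf a_j$, $\ell_0=\sum_{j=1}^m\ell_j$. Let $f_\lambda=\sum_{j=1}^m\ell_jx^{\mathbf a_j}-\ell_0\lambda x^{\mathbf a_0}$. Let $V$ be the real span of $A$, $V_{\mathbb Z}=V\cap\mathbb Z^n$, $C(A)$ the real cone generated by $A$, $M=V_{\mathbb Z}\cap C(A)$, $\mathbb ZA_+$ the group generated by $A\cup\{\mathbf a_0\}$. Fix a coset $\mathcal C_k$ of $\mathbb ZA_+$ in $V_{\mathbb Z}$, $M_k=M\cap\mathcal C_k$, $S'_k$ the $\mathbb C(\lambda)$-span of $\{x^u:u\in M_k\}$, $D_i=x_i\partial/\partial x_i+x_i\partial f_\lambda/\partial x_i$ ($i=1,\dots,n$), $D_\lambda=\partial/\partial\lambda-\ell_0x^{\mathbf a_0}$ (both preserve $S'_k$), and $\mathcal W'_k=S'_k/\sum_iD_iS'_k$, a module over $\mathbb C(\lambda)\langle\partial_\lambda\rangle$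 with $\partial_\lambda$ acting as $D_\lambda$. Let $P(A)=\{\sum_jc_j\mathbf a_j:0\le c_j<1\}$, $\mathcal B=V_{\mathbb Z}\cap P(A)$, $\mathcal B_k=\mathcal B\cap\mathcal C_k$. For $z\in\mathbb C$, $l\in\mathbb Z$: $[z]_0=1$, $[z]_l=1/((z+1)\cdots(z+l))$ for $l>0$, $[z]_l=z(z-1)\cdots(z+l+1)$ for $l<0$. For $\mathbf b'=\sum_jv_j\mathbf a_j\in\mathcal B$ ($v_j\in[0,1)$) and $u\in M$, let $g^{(\mathbf b')}_u=\prod_{j}[-v_j]_{s_j}\ell_j^{s_j}$ if $u=\sum_j(v_j-s_j)\mathbf a_j$ with all $s_j\in\mathbb Z_{\le0}$, and $0$ otherwise; and $G^{(\mathbf b')}_u(\lambda)=\sum_{s\ge0}g^{(\mathbf b')}_{u+s\mathbf a_0}\frac{(-\ell_0\lambda)^s}{s!}\in\mathbb C[[\lambda]]$. *)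

theory Defs
  imports "HOL-Analysis.Analysis" "HOL-Computational_Algebra.Computational_Algebra"
begin

text \<open>Integer vectors in Z^n are modelled as int ^ 'n (the dimension n is the
  cardinality of the finite type 'n).  The set A is the family a_1,...,a_m
  given by a :: nat => int^'n on the index set {1..m}; a_0 is a separate vector.
  The weights l_0,...,l_m are l :: nat => int on {0..m}.\<close>

definition rvec :: "int ^ 'n \<Rightarrow> real ^ 'n" where
  "rvec u = (\<chi> i. real_of_int (u $ i))"

definition Vsp :: "(nat \<Rightarrow> int ^ 'n) \<Rightarrow> nat \<Rightarrow> (real ^ 'n) set" where
  "Vsp a m = span (rvec ` a ` {1..m})"

definition VZ :: "(nat \<Rightarrow> int ^ 'n) \<Rightarrow> nat \<Rightarrow> (int ^ 'n) set" where
  "VZ a m = {u. rvec u \<in> Vsp a m}"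

definition coneA :: "(nat \<Rightarrow> int ^ 'n) \<Rightarrow> nat \<Rightarrow> (real ^ 'n) set" where
  "coneA a m = {x. \<exists>c. (\<forall>j\<in>{1..m}. 0 \<le> c j) \<and> x = (\<Sum>j\<in>{1..m}. c j *\<^sub>R rvec (a j))}"

definition Mset :: "(nat \<Rightarrow> int ^ 'n) \<Rightarrow> nat \<Rightarrow> (int ^ 'n) set" where
  "Mset a m = {u \<in> VZ a m. rvec u \<in> coneA a m}"

definition ZAplus :: "(nat \<Rightarrow> int ^ 'n) \<Rightarrow> int ^ 'n \<Rightarrow> nat \<Rightarrow> (int ^ 'n) set" where
  "ZAplus a a0 m = {u. \<exists>z::nat \<Rightarrow> int. u = z 0 *s a0 + (\<Sum>j\<in>{1..m}. z j *s a j)}"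

definition is_coset :: "(nat \<Rightarrow> int ^ 'n) \<Rightarrow> int ^ 'n \<Rightarrow> nat \<Rightarrow> (int ^ 'n) set \<Rightarrow> bool" where
  "is_coset a a0 m C \<longleftrightarrow> (\<exists>w\<in>VZ a m. C = (\<lambda>g. w + g) ` ZAplus a a0 m)"

definition PA :: "(nat \<Rightarrow> int ^ 'n) \<Rightarrow> nat \<Rightarrow> (real ^ 'n) set" where
  "PA a m = {x. \<exists>c. (\<forall>j\<in>{1..m}. 0 \<le> c j \<and> c j < 1) \<and> x = (\<Sum>j\<in>{1..m}. c j *\<^sub>R rvec (a j))}"

definition Bset :: "(nat \<Rightarrow> int ^ 'n) \<Rightarrow> nat \<Rightarrow> (int ^ 'n) set" where
  "Bset a m = {u \<in> VZ a m. rvec u \<in> PA a m}"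

text \<open>Coordinates of a vector of V with respect to the basis A (well defined by
  linear independence of A).\<close>
definition acoord :: "(nat \<Rightarrow> int ^ 'n) \<Rightarrow> nat \<Rightarrow> int ^ 'n \<Rightarrow> nat \<Rightarrow> real" where
  "acoord a m u = (THE c. (\<forall>j. j \<notin> {1..m} \<longrightarrow> c j = 0) \<and>
                          rvec u = (\<Sum>j\<in>{1..m}. c j *\<^sub>R rvec (a j)))"

definition bracket :: "complex \<Rightarrow> int \<Rightarrow> complex" where
  "bracket z l = (if l = 0 then 1
     else if l > 0 then 1 / (\<Prod>i\<in>{1..nat l}. z + of_nat i)
     else (\<Prod>i\<in>{0..<nat (- l)}. z - of_nat i))"

definition gcoef :: "(nat \<Rightarrow> int ^ 'n) \<Rightarrow> nat \<Rightarrow> (nat \<Rightarrow> int) \<Rightarrow> int ^ 'n \<Rightarrow> int ^ 'n \<Rightarrow> complex" where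
  "gcoef a m l b' u =
     (if rvec u \<in> Vsp a m \<and>
         (\<forall>j\<in>{1..m}. acoord a m b' j - acoord a m u j \<in> \<int> \<and> acoord a m b' j - acoord a m u j \<le> 0)
      then (\<Prod>j\<in>{1..m}.
              bracket (- complex_of_real (acoord a m b' j)) \<lfloor>acoord a m b' j - acoord a m u j\<rfloor>
              * complex_of_int (l j) powi \<lfloor>acoord a m b' j - acoord a m u j\<rfloor>)
      else 0)"

definition Gser :: "(nat \<Rightarrow> int ^ 'n) \<Rightarrow> int ^ 'n \<Rightarrow> nat \<Rightarrow> (nat \<Rightarrow> int) \<Rightarrow> int ^ 'n \<Rightarrow> int ^ 'n \<Rightarrow> complex fps" where
  "Gser a a0 m l b' u = Abs_fps (\<lambda>s. gcoef a m l b' (u + int s *s a0)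
        * (- complex_of_int (l 0)) ^ s / of_nat (fact s))"

type_synonym ratfun = "complex poly fract"

definition lam :: ratfun where
  "lam = Fract [:0, 1:] 1"

definition rderiv :: "ratfun \<Rightarrow> ratfun" where
  "rderiv r = (THE d. \<exists>p q. q \<noteq> 0 \<and> r = Fract p q \<and>
                  d = Fract (pderiv p * q - p * pderiv q) (q * q))"

definition rat_to_fls :: "ratfun \<Rightarrow> complex fls" where
  "rat_to_fls r = (THE f. \<exists>p q. q \<noteq> 0 \<and> r = Fract p q \<and>
                     f = fps_to_fls (fps_of_poly p) / fps_to_fls (fps_of_poly q))"

text \<open>Elements of S'_k: finitely supported coefficient functions on M_k,
  h u = coefficient of x^u.\<close>
definition Sk :: "(int ^ 'n) set \<Rightarrow> (int ^ 'n \<Rightarrow> ratfun) set" where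
  "Sk Mk = {h. finite {u. h u \<noteq> 0} \<and> {u. h u \<noteq> 0} \<subseteq> Mk}"

definition monom :: "int ^ 'n \<Rightarrow> (int ^ 'n \<Rightarrow> ratfun)" where
  "monom b = (\<lambda>u. if u = b then 1 else 0)"

text \<open>D_i = x_i d/dx_i + x_i (d f_\<lambda>/dx_i), with
  f_\<lambda> = \<Sum>_j l_j x^{a_j} - l_0 \<lambda> x^{a_0}\<close>
definition Di :: "(nat \<Rightarrow> int ^ 'n) \<Rightarrow> int ^ 'n \<Rightarrow> nat \<Rightarrow> (nat \<Rightarrow> int) \<Rightarrow> 'n
                    \<Rightarrow> (int ^ 'n \<Rightarrow> ratfun) \<Rightarrow> (int ^ 'n \<Rightarrow> ratfun)" where
  "Di a a0 m l i h = (\<lambda>u. of_int (u $ i) * h u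
       + (\<Sum>j\<in>{1..m}. of_int (l j * (a j $ i)) * h (u - a j))
       - of_int (l 0 * (a0 $ i)) * lam * h (u - a0))"

text \<open>D_\<lambda> = d/d\<lambda> - l_0 x^{a_0}\<close>
definition Dlam :: "int ^ 'n \<Rightarrow> (nat \<Rightarrow> int) \<Rightarrow> (int ^ 'n \<Rightarrow> ratfun) \<Rightarrow> (int ^ 'n \<Rightarrow> ratfun)" where
  "Dlam a0 l h = (\<lambda>u. rderiv (h u) - of_int (l 0) * h (u - a0))"

definition DiImage :: "(nat \<Rightarrow> int ^ 'n) \<Rightarrow> int ^ 'n \<Rightarrow> nat \<Rightarrow> (nat \<Rightarrow> int) \<Rightarrow> (int ^ 'n) set
                        \<Rightarrow> (int ^ 'n \<Rightarrow> ratfun) set" where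
  "DiImage a a0 m l Mk = {h. \<exists>hs. (\<forall>i. hs i \<in> Sk Mk) \<and>
                              h = (\<lambda>u. \<Sum>i\<in>UNIV. Di a a0 m l i (hs i) u)}"

end

theory Submission
  imports Defs
begin

text \<open>For each \<open>b'\<close> in \<open>\<B>\<^sub>k\<close> the functional \<open>\<Phi>\<^bsub>b'\<^esub> : x\<^sup>u \<mapsto> G\<^bsup>(b')\<^esup>\<^sub>u\<close> kills every \<open>D\<^sub>i S'\<^sub>k\<close> and turns
  \<open>D\<^sub>\<lambda>\<close> into \<open>d/d\<lambda>\<close>. The monomials \<open>x\<^sup>b\<close>, \<open>b \<in> \<B>\<^sub>k\<close>, span \<open>\<W>'\<^sub>k\<close>, and the matrix of the functionals on them is
  the identity at \<open>\<lambda> = 0\<close>. Hence an element of \<open>S'\<^sub>k\<close> vanishes in \<open>\<W>'\<^sub>k\<close> as soon as all functionals vanish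
  on it, and an operator annihilates \<open>x\<^sup>b\<close> in \<open>\<W>'\<^sub>k\<close> as soon as it annihilates all the series
  \<open>G\<^bsup>(b')\<^esup>\<^sub>b\<close>. These series are supported on the distinct residue classes modulo \<open>\<ell>\<^sub>0\<close> and satisfy a
  hypergeometric recurrence of order \<open>\<ell>\<^sub>0\<close>. The residue classes of the vanishing series contribute
  common factors to both sides; after cancelling them the order is the number of nonzero series.\<close>

section \<open>Rational functions of the parameter\<close>

text \<open>Elements of C(\<lambda>) may have poles at 0, so the functionals take values in Laurent
  series; there a matrix that is the identity at \<lambda> = 0 is seen to be nonsingular by
  comparing lowest-order terms. The obstacle is the spanning statement: modulo lower weight, a
  factor x^{a_j} can only be traded for \<lambda> x^{a_0}, which has the same weight, so no degree
  drops on the way to B_k. Residue classes enter because l_0 a_0 is an integral combination of the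
  a_j; gcd 1 keeps the l_0 classes distinct, so B_k has exactly l_0 elements. The series of class s,
  0 \<le> s < l_0, vanishes exactly when some a_j-coordinate of b + s a_0 is a positive integer, and
  that same integer yields the right-hand factor that cancels. The leading coefficient of the
  reduced operator is \<lambda>^r (1 - \<lambda>^{l_0}), with r the number of nonzero
  series.\<close>

lemma rderiv_Fract:
  assumes "q \<noteq> 0"
  shows "rderiv (Fract p q) = Fract (pderiv p * q - p * pderiv q) (q * q)"
  unfolding rderiv_def
proof (rule the_equality)
  fix d assume "\<exists>p' q'. q' \<noteq> 0 \<and> Fract p q = Fract p' q' \<and>
                  d = Fract (pderiv p' * q' - p' * pderiv q') (q' * q')"
  then obtain p' q' where q': "q' \<noteq> 0" and eq: "Fract p q = Fract p' q'"
    and d: "d = Fract (pderiv p' * q' - p' * pderiv q') (q' * q')" by blast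
  have e: "p * q' = p' * q" using eq assms q' by (simp add: eq_fract)
  \<comment> \<open>Differentiating the cross-multiplied identity gives a second relation; the two
    together make the quotient rule independent of the representative.\<close>
  have "pderiv (p * q') = pderiv (p' * q)" using e by simp
  hence e': "p * pderiv q' + pderiv p * q' = p' * pderiv q + pderiv p' * q"
    by (simp add: pderiv_mult mult.commute)
  have "(pderiv p' * q' - p' * pderiv q') * (q * q) = (pderiv p * q - p * pderiv q) * (q' * q')"
    using e e' by algebra
  thus "d = Fract (pderiv p * q - p * pderiv q) (q * q)"
    using d assms q' by (simp add: eq_fract)
qed (use assms in blast)

lemma rat_to_fls_Fract:
  assumes "q \<noteq> 0"
  shows "rat_to_fls (Fract p q) = fps_to_fls (fps_of_poly p) / fps_to_fls (fps_of_poly q)"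
  unfolding rat_to_fls_def
proof (rule the_equality)
  fix f assume "\<exists>p' q'. q' \<noteq> 0 \<and> Fract p q = Fract p' q' \<and>
                  f = fps_to_fls (fps_of_poly p') / fps_to_fls (fps_of_poly q')"
  then obtain p' q' where q': "q' \<noteq> 0" and eq: "Fract p q = Fract p' q'"
    and f: "f = fps_to_fls (fps_of_poly p') / fps_to_fls (fps_of_poly q')" by blast
  have "p * q' = p' * q" using eq assms q' by (simp add: eq_fract)
  hence "fps_to_fls (fps_of_poly p) * fps_to_fls (fps_of_poly q')
       = fps_to_fls (fps_of_poly p') * fps_to_fls (fps_of_poly q)"
    by (metis fps_of_poly_mult fls_times_fps_to_fls)
  thus "f = fps_to_fls (fps_of_poly p) / fps_to_fls (fps_of_poly q)"
    using f assms q' by (simp add: frac_eq_eq)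
qed (use assms in blast)

definition constR :: "complex \<Rightarrow> ratfun" where
  "constR c = Fract [:c:] 1"

lemma constR_0 [simp]: "constR 0 = 0"
  by (simp add: constR_def Zero_fract_def)

lemma constR_1 [simp]: "constR 1 = 1"
  by (simp add: constR_def One_fract_def one_pCons)

lemma constR_add: "constR (x + y) = constR x + constR y"
  by (simp add: constR_def)

lemma constR_mult: "constR (x * y) = constR x * constR y"
  by (simp add: constR_def mult.commute)

lemma constR_uminus: "constR (- x) = - constR x"
  by (simp add: constR_def)

lemma constR_sum: "constR (sum f A) = (\<Sum>x\<in>A. constR (f x))"
  by (induction A rule: infinite_finite_induct) (auto simp: constR_add)

lemma constR_of_nat: "constR (of_nat k) = of_nat k"
  by (induction k) (auto simp: constR_add)

lemma constR_of_int: "constR (of_int k) = of_int k"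
proof (cases k rule: int_cases2)
  case (nonneg n) thus ?thesis by (simp add: constR_of_nat)
next
  case (nonpos n) thus ?thesis by (simp add: constR_of_nat constR_uminus)
qed

lemma rat_to_fls_constR: "rat_to_fls (constR c) = fls_const c"
  by (simp add: constR_def rat_to_fls_Fract fps_of_poly_const)

lemma rat_to_fls_0 [simp]: "rat_to_fls 0 = 0"
  using rat_to_fls_constR[of 0] by simp

lemma rat_to_fls_1 [simp]: "rat_to_fls 1 = 1"
  using rat_to_fls_constR[of 1] by simp

lemma rat_to_fls_lam: "rat_to_fls lam = fls_X"
  by (simp add: lam_def rat_to_fls_Fract fps_of_poly_pCons fps_of_poly_const)

lemma rat_to_fls_add: "rat_to_fls (x + y) = rat_to_fls x + rat_to_fls y"
  by (cases x; cases y)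
    (simp add: rat_to_fls_Fract fps_of_poly_add fps_of_poly_mult fls_times_fps_to_fls add_frac_eq)

lemma rat_to_fls_mult: "rat_to_fls (x * y) = rat_to_fls x * rat_to_fls y"
  by (cases x; cases y)
    (simp add: rat_to_fls_Fract fps_of_poly_mult fls_times_fps_to_fls)

lemma rat_to_fls_uminus: "rat_to_fls (- x) = - rat_to_fls x"
  using rat_to_fls_add[of x "- x"] by (simp add: eq_neg_iff_add_eq_0 add.commute)

lemma rat_to_fls_diff: "rat_to_fls (x - y) = rat_to_fls x - rat_to_fls y"
  using rat_to_fls_add[of x "- y"] by (simp add: rat_to_fls_uminus)

lemma rat_to_fls_power: "rat_to_fls (x ^ n) = rat_to_fls x ^ n"
  by (induction n) (auto simp: rat_to_fls_mult)

lemma rat_to_fls_sum: "rat_to_fls (sum f A) = (\<Sum>x\<in>A. rat_to_fls (f x))"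
  by (induction A rule: infinite_finite_induct) (auto simp: rat_to_fls_add)

lemma rat_to_fls_of_int: "rat_to_fls (of_int k) = fls_const (of_int k)"
  using rat_to_fls_constR[of "of_int k"] by (simp add: constR_of_int)

text \<open>Injectivity of the expansion at 0: non-vanishing in C(\<lambda>) can be tested on
  Laurent series.\<close>

lemma rat_to_fls_eq_0_iff [simp]: "rat_to_fls x = 0 \<longleftrightarrow> x = 0"
proof
  assume z: "rat_to_fls x = 0"
  show "x = 0"
  proof (cases x)
    case (Fract p q)
    with z have "p = 0" by (simp add: rat_to_fls_Fract)
    thus ?thesis using Fract by (simp add: fract_collapse)
  qed
qed simp

lemma ratfun_of_int_eq_0_iff: "(of_int k :: ratfun) = 0 \<longleftrightarrow> k = 0"
  unfolding rat_to_fls_eq_0_iff[symmetric] rat_to_fls_of_int by simp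

text \<open>The quotient rule, recovered by differentiating \<open>x * q = p\<close> as an identity
  of Laurent series.\<close>

lemma rat_to_fls_rderiv: "rat_to_fls (rderiv x) = fls_deriv (rat_to_fls x)"
proof (cases x)
  case (Fract p q)
  let ?F = "\<lambda>p. fps_to_fls (fps_of_poly p) :: complex fls"
  have q: "?F q \<noteq> 0" using Fract by simp
  have dF: "fls_deriv (?F p) = ?F (pderiv p)" for p
    by (simp add: fls_deriv_fps_to_fls fps_of_poly_pderiv)
  have xq: "rat_to_fls x * ?F q = ?F p" using Fract q by (simp add: rat_to_fls_Fract)
  hence "fls_deriv (rat_to_fls x * ?F q) = ?F (pderiv p)" by (simp add: dF)
  hence "fls_deriv (rat_to_fls x) * ?F q = ?F (pderiv p) - rat_to_fls x * ?F (pderiv q)"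
    by (simp add: dF eq_diff_eq add.commute)
  moreover have "d * (y * y) = p' * y - (r * y) * q'" if "d * y = p' - r * q'" for d r y p' q' :: "complex fls"
  proof -
    have "d * (y * y) = (p' - r * q') * y" by (simp only: that mult.assoc[symmetric])
    thus ?thesis by (simp add: algebra_simps)
  qed
  ultimately have "fls_deriv (rat_to_fls x) * (?F q * ?F q)
       = ?F (pderiv p) * ?F q - (rat_to_fls x * ?F q) * ?F (pderiv q)"
    by blast
  hence "fls_deriv (rat_to_fls x) * (?F q * ?F q) = ?F (pderiv p) * ?F q - ?F p * ?F (pderiv q)"
    unfolding xq .
  moreover have "rat_to_fls (rderiv x) * (?F q * ?F q) = ?F (pderiv p) * ?F q - ?F p * ?F (pderiv q)"
    using Fract q
    by (simp add: rderiv_Fract rat_to_fls_Fract fps_of_poly_diff fps_of_poly_mult fls_times_fps_to_fls)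
  ultimately show ?thesis using q by (metis mult_cancel_right mult_eq_0_iff)
qed

lemma rderiv_constR [simp]: "rderiv (constR c) = 0"
  by (simp add: constR_def rderiv_Fract fract_collapse pderiv_pCons)

lemma rderiv_0 [simp]: "rderiv 0 = 0"
  using rderiv_constR[of 0] by simp

text \<open>The constant term is 1. This is needed twice: to leave a cycle of exchanges, and for the
  leading coefficient of the operator.\<close>

lemma lam_power_neq_1:
  assumes "k > 0" shows "1 - lam ^ k \<noteq> 0"
proof
  assume "1 - lam ^ k = 0"
  hence "fps_to_fls (1 - fps_X ^ k :: complex fps) = 0"
    by (metis rat_to_fls_0 rat_to_fls_1 rat_to_fls_diff rat_to_fls_power rat_to_fls_lam
        fps_to_fls_minus fps_to_fls_power fps_X_to_fls fps_one_to_fls)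
  hence "1 - fps_X ^ k = (0 :: complex fps)" by (simp only: fps_to_fls_eq_0_iff)
  hence "fps_nth (1 - fps_X ^ k :: complex fps) 0 = 0" by (simp only: fps_zero_nth)
  thus False using assms by simp
qed

lemma lam_neq_0: "lam \<noteq> 0"
  using rat_to_fls_eq_0_iff[of lam] by (simp add: rat_to_fls_lam)

section \<open>Lowest-order terms of Laurent series\<close>

lemma fls_times_fps_nth_bottom:
  fixes f :: "complex fls"
  assumes "\<And>i. i < k \<Longrightarrow> fls_nth f i = 0"
  shows "fls_nth (f * fps_to_fls g) k = fls_nth f k * fps_nth g 0"
proof -
  define F where "F = Abs_fps (\<lambda>n. fls_nth f (k + int n))"
  have f: "f = fls_shift (- k) (fps_to_fls F)"
  proof (rule fls_eqI)
    fix i show "fls_nth f i = fls_nth (fls_shift (- k) (fps_to_fls F)) i"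
      using assms[of i] by (cases "i < k") (auto simp: F_def)
  qed
  have "f * fps_to_fls g = fls_shift (- k) (fps_to_fls (F * g))"
    unfolding f by (simp add: fls_shifted_times_simps fls_times_fps_to_fls)
  thus ?thesis by (simp add: F_def)
qed

text \<open>At the lowest order \<open>k\<close> occurring among the \<open>f y\<close>, only the
  constant terms of the matrix matter. These form the identity, so the equation of row
  \<open>x\<close> forces the order \<open>k\<close> coefficient of \<open>f x\<close> to vanish,
  although \<open>x\<close> was chosen to attain \<open>k\<close>.\<close>

lemma fls_family_zero:
  fixes f :: "'a \<Rightarrow> complex fls"
  assumes fin: "finite A"
    and sum0: "\<And>x. x \<in> A \<Longrightarrow> (\<Sum>y\<in>A. f y * fps_to_fls (G x y)) = 0"
    and diag: "\<And>x y. x \<in> A \<Longrightarrow> y \<in> A \<Longrightarrow> fps_nth (G x y) 0 = (if x = y then 1 else 0)"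
    and "y \<in> A"
  shows "f y = 0"
proof (rule ccontr)
  assume "f y \<noteq> 0"
  \<comment> \<open>Zero entries are left out: the subdegree of 0 is 0 by convention and could
    falsify the minimum.\<close>
  define N where "N = {y \<in> A. f y \<noteq> 0}"
  have N: "finite N" "N \<noteq> {}" using fin \<open>f y \<noteq> 0\<close> \<open>y \<in> A\<close> by (auto simp: N_def)
  define k where "k = Min ((\<lambda>y. fls_subdegree (f y)) ` N)"
  have "k \<in> (\<lambda>y. fls_subdegree (f y)) ` N" unfolding k_def using N by (intro Min_in) auto
  then obtain x where x: "x \<in> N" "fls_subdegree (f x) = k" by auto
  have low: "fls_nth (f y) i = 0" if "y \<in> A" "i < k" for y i
  proof (cases "f y = 0")
    case False
    hence "k \<le> fls_subdegree (f y)" using that N unfolding k_def N_def by (intro Min_le) auto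
    thus ?thesis using that by (intro fls_eq0_below_subdegree) auto
  qed simp
  have "0 = fls_nth (\<Sum>y\<in>A. f y * fps_to_fls (G x y)) k" using sum0[of x] x by (simp add: N_def)
  also have "\<dots> = (\<Sum>y\<in>A. fls_nth (f y) k * fps_nth (G x y) 0)"
    using fls_times_fps_nth_bottom[OF low] by (simp add: fls_nth_sum)
  also have "\<dots> = (\<Sum>y\<in>A. if y = x then fls_nth (f y) k else 0)"
    using x diag by (intro sum.cong) (auto simp: N_def)
  also have "\<dots> = fls_nth (f x) k" using fin x by (simp add: N_def)
  finally have "fls_nth (f x) k = 0" by simp
  moreover have "f x \<noteq> 0" using x by (simp add: N_def)
  ultimately show False using x nth_fls_subdegree_nonzero by blast
qed

section \<open>Coordinates with respect to A\<close>

lemma rvec_add: "rvec (u + v) = rvec u + rvec v"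
  by (simp add: rvec_def vec_eq_iff)

lemma rvec_diff: "rvec (u - v) = rvec u - rvec v"
  by (simp add: rvec_def vec_eq_iff)

lemma rvec_smult: "rvec (c *s u) = of_int c *\<^sub>R rvec u"
  by (simp add: rvec_def vec_eq_iff)

lemma rvec_0 [simp]: "rvec 0 = 0"
  by (simp add: rvec_def vec_eq_iff)

lemma rvec_sum: "rvec (sum f A) = (\<Sum>x\<in>A. rvec (f x))"
  by (induction A rule: infinite_finite_induct) (auto simp: rvec_add)

lemma rvec_eq_iff [simp]: "rvec u = rvec v \<longleftrightarrow> u = v"
  by (simp add: rvec_def vec_eq_iff)

lemma finite_vec_bounded:
  fixes S :: "'a set"
  assumes "finite S"
  shows "finite {x :: 'a ^ 'n. \<forall>i. x $ i \<in> S}"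
proof (rule finite_subset)
  show "{x :: 'a ^ 'n. \<forall>i. x $ i \<in> S} \<subseteq> vec_lambda ` (UNIV \<rightarrow>\<^sub>E S)"
  proof
    fix x :: "'a ^ 'n" assume "x \<in> {x. \<forall>i. x $ i \<in> S}"
    hence "vec_nth x \<in> UNIV \<rightarrow>\<^sub>E S" by (auto simp: PiE_UNIV_domain)
    thus "x \<in> vec_lambda ` (UNIV \<rightarrow>\<^sub>E S)" by (metis image_eqI vec_nth_inverse)
  qed
  show "finite (vec_lambda ` (UNIV \<rightarrow>\<^sub>E S) :: ('a ^ 'n) set)"
    using assms by (intro finite_imageI finite_PiE) auto
qed

locale lattice_relation =
  fixes a :: "nat \<Rightarrow> int ^ 'n" and a0 :: "int ^ 'n" and m :: nat and l :: "nat \<Rightarrow> int"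
  assumes inj: "inj_on a {1..m}"
    and indep: "independent (rvec ` a ` {1..m})"
    and lpos: "\<forall>j\<in>{0..m}. 0 < l j"
    and lgcd: "Gcd (l ` {0..m}) = 1"
    and rel: "l 0 *s a0 = (\<Sum>j\<in>{1..m}. l j *s a j)"
    and lsum: "l 0 = (\<Sum>j\<in>{1..m}. l j)"
begin

text \<open>The basis dual to A, as linear forms on the whole space. Their values off the span of A
  are arbitrary, hence the choice operator.\<close>

definition dual :: "nat \<Rightarrow> real ^ 'n \<Rightarrow> real" where
  "dual j = (SOME f. linear f \<and> (\<forall>k\<in>{1..m}. f (rvec (a k)) = (if k = j then 1 else 0)))"

definition co :: "nat \<Rightarrow> int ^ 'n \<Rightarrow> real" where
  "co j u = dual j (rvec u)"

lemma dual:
  assumes "j \<in> {1..m}"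
  shows linear_dual: "linear (dual j)"
    and dual_a: "k \<in> {1..m} \<Longrightarrow> dual j (rvec (a k)) = (if k = j then 1 else 0)"
proof -
  obtain g where g: "linear g" "\<forall>x\<in>rvec ` a ` {1..m}. g x = (if x = rvec (a j) then 1 else 0 :: real)"
    using linear_independent_extend[OF indep, of "\<lambda>x. if x = rvec (a j) then 1 else 0 :: real"]
    by (elim exE conjE)
  have "g (rvec (a k)) = (if k = j then 1 else 0)" if "k \<in> {1..m}" for k
    using bspec[OF g(2), of "rvec (a k)"] that assms inj_onD[OF inj, of k j] by auto
  with g(1) have "\<exists>f. linear f \<and> (\<forall>k\<in>{1..m}. f (rvec (a k)) = (if k = j then 1 else 0 :: real))"
    by (intro exI[of _ g]) simp
  hence *: "linear (dual j) \<and> (\<forall>k\<in>{1..m}. dual j (rvec (a k)) = (if k = j then 1 else 0 :: real))"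
    unfolding dual_def by (rule someI_ex)
  show "linear (dual j)" using * by (rule conjunct1)
  show "dual j (rvec (a k)) = (if k = j then 1 else 0)" if "k \<in> {1..m}"
    using bspec[OF conjunct2[OF *] that] .
qed

lemma co_add: "j \<in> {1..m} \<Longrightarrow> co j (u + v) = co j u + co j v"
  by (simp add: co_def rvec_add linear_add[OF linear_dual])

lemma co_diff: "j \<in> {1..m} \<Longrightarrow> co j (u - v) = co j u - co j v"
  by (simp add: co_def rvec_diff linear_diff[OF linear_dual])

lemma co_smult: "j \<in> {1..m} \<Longrightarrow> co j (c *s u) = of_int c * co j u"
  by (simp add: co_def rvec_smult linear_scale[OF linear_dual])

lemma co_sum: "j \<in> {1..m} \<Longrightarrow> co j (sum f A) = (\<Sum>x\<in>A. co j (f x))"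
  by (simp add: co_def rvec_sum linear_sum[OF linear_dual])

lemma co_a: "j \<in> {1..m} \<Longrightarrow> k \<in> {1..m} \<Longrightarrow> co j (a k) = (if k = j then 1 else 0)"
  by (simp add: co_def dual_a)

lemma co_lincomb:
  assumes "j \<in> {1..m}"
  shows "co j (\<Sum>k\<in>{1..m}. z k *s a k) = of_int (z j)"
proof -
  have "co j (\<Sum>k\<in>{1..m}. z k *s a k) = (\<Sum>k\<in>{1..m}. if k = j then of_int (z j) else 0)"
    unfolding co_sum[OF assms] using assms by (intro sum.cong) (auto simp: co_smult co_a)
  thus ?thesis using assms by simp
qed

lemma l_pos [simp]: "j \<in> {1..m} \<Longrightarrow> 0 < l j" and l0_pos [simp]: "0 < l 0"
  using lpos by auto

lemma co_a0: "j \<in> {1..m} \<Longrightarrow> co j a0 = of_int (l j) / of_int (l 0)"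
  using co_lincomb[of j l] l0_pos
  by (simp add: rel[symmetric] co_smult eq_divide_eq mult.commute del: l0_pos One_nat_def)

lemma co_a0_pos: "j \<in> {1..m} \<Longrightarrow> 0 < co j a0"
  using l0_pos l_pos by (simp add: co_a0 del: l0_pos l_pos)

lemma a_in_VZ: "j \<in> {1..m} \<Longrightarrow> a j \<in> VZ a m"
  by (auto simp: VZ_def Vsp_def intro: span_base)

lemma VZ_0: "0 \<in> VZ a m"
  by (simp add: VZ_def Vsp_def span_zero)

lemma VZ_add: "u \<in> VZ a m \<Longrightarrow> v \<in> VZ a m \<Longrightarrow> u + v \<in> VZ a m"
  by (simp add: VZ_def Vsp_def rvec_add span_add)

lemma VZ_diff: "u \<in> VZ a m \<Longrightarrow> v \<in> VZ a m \<Longrightarrow> u - v \<in> VZ a m"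
  by (simp add: VZ_def Vsp_def rvec_diff span_diff)

lemma VZ_smult: "u \<in> VZ a m \<Longrightarrow> c *s u \<in> VZ a m"
  by (simp add: VZ_def Vsp_def rvec_smult span_scale)

lemma VZ_sum: "(\<And>x. x \<in> A \<Longrightarrow> f x \<in> VZ a m) \<Longrightarrow> sum f A \<in> VZ a m"
  by (induction A rule: infinite_finite_induct) (auto simp: VZ_0 VZ_add)

lemma a0_in_VZ: "a0 \<in> VZ a m"
proof -
  have "rvec (l 0 *s a0) \<in> Vsp a m"
    unfolding rel using VZ_sum[of "{1..m}" "\<lambda>j. l j *s a j"] a_in_VZ VZ_smult by (simp add: VZ_def)
  hence "(1 / of_int (l 0)) *\<^sub>R rvec (l 0 *s a0) \<in> Vsp a m"
    unfolding Vsp_def by (rule span_scale)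
  moreover have "(1 / of_int (l 0)) *\<^sub>R rvec (l 0 *s a0) = rvec a0"
    using l0_pos by (simp add: rvec_smult del: l0_pos)
  ultimately show ?thesis by (simp add: VZ_def)
qed

text \<open>Both sides are linear in \<open>x\<close> and agree on the generators.\<close>

lemma Vsp_expand:
  assumes "x \<in> Vsp a m"
  shows "x = (\<Sum>j\<in>{1..m}. dual j x *\<^sub>R rvec (a j))"
  using assms unfolding Vsp_def
proof (rule span_induct)
  show "subspace {x. x = (\<Sum>j\<in>{1..m}. dual j x *\<^sub>R rvec (a j))}"
    (is "subspace ?S")
  proof (rule subspaceI)
    show "0 \<in> ?S" by (simp add: linear_0[OF linear_dual])
  next
    fix x y assume "x \<in> ?S" "y \<in> ?S"
    hence "x + y = (\<Sum>j\<in>{1..m}. dual j x *\<^sub>R rvec (a j)) + (\<Sum>j\<in>{1..m}. dual j y *\<^sub>R rvec (a j))"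
      unfolding mem_Collect_eq by (rule arg_cong2)
    also have "\<dots> = (\<Sum>j\<in>{1..m}. dual j (x + y) *\<^sub>R rvec (a j))"
      unfolding sum.distrib[symmetric]
      by (intro sum.cong) (auto simp: linear_add[OF linear_dual] scaleR_add_left)
    finally show "x + y \<in> ?S" unfolding mem_Collect_eq .
  next
    fix c x assume "x \<in> ?S"
    hence "c *\<^sub>R x = c *\<^sub>R (\<Sum>j\<in>{1..m}. dual j x *\<^sub>R rvec (a j))"
      unfolding mem_Collect_eq by (rule arg_cong)
    also have "\<dots> = (\<Sum>j\<in>{1..m}. dual j (c *\<^sub>R x) *\<^sub>R rvec (a j))"
      unfolding scaleR_sum_right
      by (intro sum.cong) (auto simp: linear_scale[OF linear_dual])
    finally show "c *\<^sub>R x \<in> ?S" unfolding mem_Collect_eq .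
  qed
next
  fix x assume "x \<in> rvec ` a ` {1..m}"
  then obtain k where k: "k \<in> {1..m}" "x = rvec (a k)" by blast
  have "(\<Sum>j\<in>{1..m}. dual j x *\<^sub>R rvec (a j)) = (\<Sum>j\<in>{1..m}. if j = k then rvec (a k) else 0)"
    using k by (intro sum.cong) (auto simp: dual_a)
  thus "x = (\<Sum>j\<in>{1..m}. dual j x *\<^sub>R rvec (a j))" using k by simp
qed

lemma dual_lincomb:
  assumes "j \<in> {1..m}"
  shows "dual j (\<Sum>k\<in>{1..m}. c k *\<^sub>R rvec (a k)) = c j"
proof -
  have "dual j (\<Sum>k\<in>{1..m}. c k *\<^sub>R rvec (a k)) = (\<Sum>k\<in>{1..m}. if k = j then c j else 0)"
    unfolding linear_sum[OF linear_dual[OF assms]] using assms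
    by (intro sum.cong) (auto simp: linear_scale[OF linear_dual] dual_a)
  thus ?thesis using assms by simp
qed

lemma VZ_expand: "u \<in> VZ a m \<Longrightarrow> rvec u = (\<Sum>j\<in>{1..m}. co j u *\<^sub>R rvec (a j))"
  unfolding co_def by (rule Vsp_expand) (simp add: VZ_def)

lemma VZ_eqI:
  assumes "u \<in> VZ a m" "v \<in> VZ a m" "\<And>j. j \<in> {1..m} \<Longrightarrow> co j u = co j v"
  shows "u = v"
proof -
  have "rvec u = rvec v" using VZ_expand[OF assms(1)] VZ_expand[OF assms(2)] assms(3) by simp
  thus ?thesis by simp
qed

text \<open>Applying the dual forms to any expansion shows that it is unique. From here on the
  description operator is replaced by the linear form \<open>co j\<close>.\<close>

lemma acoord_eq:
  assumes "u \<in> VZ a m" "j \<in> {1..m}"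
  shows "acoord a m u j = co j u"
proof -
  have "acoord a m u = (\<lambda>j. if j \<in> {1..m} then co j u else 0)"
    unfolding acoord_def
  proof (rule the_equality)
    fix c assume c: "(\<forall>j. j \<notin> {1..m} \<longrightarrow> c j = 0) \<and> rvec u = (\<Sum>j\<in>{1..m}. c j *\<^sub>R rvec (a j))"
    hence "co j u = c j" if "j \<in> {1..m}" for j using dual_lincomb[OF that, of c] by (simp add: co_def)
    thus "c = (\<lambda>j. if j \<in> {1..m} then co j u else 0)" using c by auto
  next
    have "(\<Sum>j\<in>{1..m}. (if j \<in> {1..m} then co j u else 0) *\<^sub>R rvec (a j)) = rvec u"
      unfolding VZ_expand[OF assms(1)] by (intro sum.cong) auto
    thus "(\<forall>j. j \<notin> {1..m} \<longrightarrow> (if j \<in> {1..m} then co j u else 0) = 0) \<and>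
        rvec u = (\<Sum>j\<in>{1..m}. (if j \<in> {1..m} then co j u else 0) *\<^sub>R rvec (a j))" by simp
  qed
  thus ?thesis using assms by simp
qed

lemma Mset_iff: "u \<in> Mset a m \<longleftrightarrow> u \<in> VZ a m \<and> (\<forall>j\<in>{1..m}. 0 \<le> co j u)"
proof -
  have "(\<forall>j\<in>{1..m}. 0 \<le> co j u)" if "rvec u \<in> coneA a m"
    using that dual_lincomb unfolding coneA_def co_def by fastforce
  moreover have "rvec u \<in> coneA a m" if "u \<in> VZ a m" "\<forall>j\<in>{1..m}. 0 \<le> co j u"
    using that(2) VZ_expand[OF that(1)] unfolding coneA_def
    by (intro CollectI exI[of _ "\<lambda>j. co j u"] conjI)
  ultimately show ?thesis unfolding Mset_def by auto
qed

lemma Bset_iff: "u \<in> Bset a m \<longleftrightarrow> u \<in> VZ a m \<and> (\<forall>j\<in>{1..m}. 0 \<le> co j u \<and> co j u < 1)"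
proof -
  have "(\<forall>j\<in>{1..m}. 0 \<le> co j u \<and> co j u < 1)" if "rvec u \<in> PA a m"
    using that dual_lincomb unfolding PA_def co_def by fastforce
  moreover have "rvec u \<in> PA a m" if "u \<in> VZ a m" "\<forall>j\<in>{1..m}. 0 \<le> co j u \<and> co j u < 1"
    using that(2) VZ_expand[OF that(1)] unfolding PA_def
    by (intro CollectI exI[of _ "\<lambda>j. co j u"] conjI)
  ultimately show ?thesis unfolding Bset_def by auto
qed

lemma Bset_subset_Mset: "Bset a m \<subseteq> Mset a m"
  by (auto simp: Bset_iff Mset_iff)

text \<open>The grading: a linear form equal to 1 on each a_j and, because \<open>l 0\<close> is the
  sum of the other weights, also on a_0. All exponents of f_\<lambda> thus have weight 1.\<close>

definition wt :: "int ^ 'n \<Rightarrow> real" where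
  "wt u = (\<Sum>j\<in>{1..m}. co j u)"

lemma wt_add: "wt (u + v) = wt u + wt v" and wt_diff: "wt (u - v) = wt u - wt v"
  by (auto simp: wt_def co_add co_diff sum.distrib sum_subtractf)

lemma wt_a: "k \<in> {1..m} \<Longrightarrow> wt (a k) = 1"
  by (simp add: wt_def co_a)

lemma wt_a0: "wt a0 = 1"
proof -
  have "wt a0 = of_int (\<Sum>j\<in>{1..m}. l j) / of_int (l 0)"
    by (simp add: wt_def co_a0 sum_divide_distrib)
  thus ?thesis using l0_pos unfolding lsum[symmetric] by (simp del: l0_pos)
qed

text \<open>On the cone the coordinates are nonnegative, so a bound on their sum bounds each of
  them, hence the norm; a bounded set contains only finitely many integer points.\<close>

lemma finite_Mset_wt: "finite {u \<in> Mset a m. wt u \<le> W}"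
proof -
  define K where "K = (\<Sum>j\<in>{1..m}. W * norm (rvec (a j)))"
  have "u \<in> {x :: int ^ 'n. \<forall>i. x $ i \<in> {-\<lceil>K\<rceil>..\<lceil>K\<rceil>}}" if u: "u \<in> Mset a m" "wt u \<le> W" for u
  proof -
    have le: "co j u \<le> W" if j: "j \<in> {1..m}" for j
    proof -
      have "co j u \<le> wt u" unfolding wt_def
        using u j by (intro member_le_sum) (auto simp: Mset_iff)
      thus ?thesis using u by simp
    qed
    have "norm (rvec u) \<le> (\<Sum>j\<in>{1..m}. norm (co j u *\<^sub>R rvec (a j)))"
      using u VZ_expand[of u] norm_sum by (metis Mset_iff)
    also have "\<dots> \<le> K" unfolding K_def
      using u le by (intro sum_mono) (auto simp: Mset_iff intro!: mult_right_mono)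
    finally have K: "norm (rvec u) \<le> K" .
    have "u $ i \<in> {-\<lceil>K\<rceil>..\<lceil>K\<rceil>}" for i
    proof -
      have "\<bar>real_of_int (u $ i)\<bar> \<le> K"
        using component_le_norm_cart[of "rvec u" i] K by (simp add: rvec_def)
      thus ?thesis by (simp add: abs_le_iff) linarith
    qed
    thus ?thesis by simp
  qed
  hence "{u \<in> Mset a m. wt u \<le> W} \<subseteq> {x :: int ^ 'n. \<forall>i. x $ i \<in> {-\<lceil>K\<rceil>..\<lceil>K\<rceil>}}"
    by blast
  thus ?thesis by (rule finite_subset) (rule finite_vec_bounded[OF finite_atLeastAtMost_int])
qed

section \<open>Translations within the cone and within a coset\<close>

lemma Mset_add_a0: "u \<in> Mset a m \<Longrightarrow> u + a0 \<in> Mset a m"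
  using less_imp_le[OF co_a0_pos] by (simp add: Mset_iff co_add VZ_add a0_in_VZ)

lemma Mset_add_a: "u \<in> Mset a m \<Longrightarrow> k \<in> {1..m} \<Longrightarrow> u + a k \<in> Mset a m"
  by (auto simp: Mset_iff co_add VZ_add a_in_VZ co_a)

lemma coset_rel:
  assumes "is_coset a a0 m C" "u \<in> C" "v \<in> C"
  shows "\<exists>z0 z. v = u + z0 *s a0 + (\<Sum>j\<in>{1..m}. z j *s a j)"
proof -
  obtain w y z where "u = w + (y 0 *s a0 + (\<Sum>j\<in>{1..m}. y j *s a j))"
    "v = w + (z 0 *s a0 + (\<Sum>j\<in>{1..m}. z j *s a j))"
    using assms unfolding is_coset_def ZAplus_def by blast
  hence "v = u + (z 0 - y 0) *s a0 + (\<Sum>j\<in>{1..m}. (z j - y j) *s a j)"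
    by (simp add: vector_sub_rdistrib sum_subtractf)
  thus ?thesis by (intro exI)
qed

lemma coset_add:
  assumes "is_coset a a0 m C" "u \<in> C"
  shows "u + z0 *s a0 + (\<Sum>j\<in>{1..m}. z j *s a j) \<in> C"
proof -
  obtain w y where w: "w \<in> VZ a m" "C = (\<lambda>g. w + g) ` ZAplus a a0 m"
     and y: "u = w + (y 0 *s a0 + (\<Sum>j\<in>{1..m}. y j *s a j))"
    using assms unfolding is_coset_def ZAplus_def by blast
  define x where "x = (\<lambda>j. y j + (if j = 0 then z0 else z j))"
  have "(\<Sum>j\<in>{1..m}. x j *s a j) = (\<Sum>j\<in>{1..m}. y j *s a j) + (\<Sum>j\<in>{1..m}. z j *s a j)"
    unfolding sum.distrib[symmetric] by (intro sum.cong) (auto simp: x_def vector_sadd_rdistrib)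
  hence "u + z0 *s a0 + (\<Sum>j\<in>{1..m}. z j *s a j) = w + (x 0 *s a0 + (\<Sum>j\<in>{1..m}. x j *s a j))"
    by (simp add: y x_def vector_sadd_rdistrib)
  thus ?thesis using w unfolding ZAplus_def by blast
qed

lemma coset_add_a0_smult: "is_coset a a0 m C \<Longrightarrow> u \<in> C \<Longrightarrow> u + z *s a0 \<in> C"
  using coset_add[of C u z "\<lambda>_. 0"] by simp

lemma coset_add_a0: "is_coset a a0 m C \<Longrightarrow> u \<in> C \<Longrightarrow> u + a0 \<in> C"
  using coset_add_a0_smult[of C u 1] by simp

lemma coset_add_a_smult:
  assumes "is_coset a a0 m C" "u \<in> C" "k \<in> {1..m}"
  shows "u + z *s a k \<in> C"
proof -
  have "(\<Sum>j\<in>{1..m}. (if j = k then z else 0) *s a j) = (\<Sum>j\<in>{1..m}. if j = k then z *s a k else 0)"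
    by (intro sum.cong) auto
  thus ?thesis using coset_add[OF assms(1,2), of 0 "\<lambda>j. if j = k then z else 0"] assms by simp
qed

end

section \<open>The coefficients g and the series G\<close>

text \<open>The exponents s_j in \<open>gcoef\<close> are never positive, so only this polynomial
  branch of the bracket occurs.\<close>

lemma bracket_neg_nat: "bracket z (- int k) = (\<Prod>i<k. z - of_nat i)"
  by (simp add: bracket_def atLeast0LessThan)

lemma Suc_mult_power_fact:
  fixes z :: complex
  shows "of_nat (Suc s) * (z ^ Suc s / of_nat (fact (Suc s))) = z * (z ^ s / of_nat (fact s))"
proof -
  have "(of_nat (fact (Suc s)) :: complex) = of_nat (Suc s) * of_nat (fact s)"
    by (simp only: fact_Suc of_nat_mult of_nat_id)
  thus ?thesis by (simp del: of_nat_Suc of_nat_fact fact_Suc)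
qed

lemma frac_eq_less_1:
  fixes x y :: real
  assumes "x - y \<in> \<int>" "0 \<le> x" "x < 1" "0 \<le> y" "y < 1"
  shows "x = y"
proof -
  obtain k :: int where k: "x - y = of_int k" using assms(1) Ints_cases by blast
  hence "\<bar>real_of_int k\<bar> < 1" using assms by linarith
  hence "k = 0" by linarith
  thus ?thesis using k by simp
qed

context lattice_relation
begin

text \<open>The support condition of \<open>gcoef\<close> in V_Z: u = b' + \<Sum> n_j a_j with
  natural numbers n_j = - s_j.\<close>

definition int_above :: "int ^ 'n \<Rightarrow> int ^ 'n \<Rightarrow> bool" where
  "int_above b' u \<longleftrightarrow> (\<forall>j\<in>{1..m}. co j u - co j b' \<in> \<nat>)"

lemma gcoef_0:
  assumes "b' \<in> VZ a m" "u \<in> VZ a m" "\<not> int_above b' u"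
  shows "gcoef a m l b' u = 0"
proof -
  have "\<not> (\<forall>j\<in>{1..m}. co j b' - co j u \<in> \<int> \<and> co j b' - co j u \<le> 0)"
  proof
    assume *: "\<forall>j\<in>{1..m}. co j b' - co j u \<in> \<int> \<and> co j b' - co j u \<le> 0"
    have "co j u - co j b' \<in> \<nat>" if "j \<in> {1..m}" for j
    proof -
      have "- (co j b' - co j u) \<in> \<int>" using bspec[OF * that] by (intro Ints_minus) simp
      thus ?thesis using bspec[OF * that] by (auto simp: Nats_altdef2)
    qed
    thus False using assms(3) by (simp add: int_above_def)
  qed
  thus ?thesis using assms(1,2) by (auto simp: gcoef_def acoord_eq)
qed

lemma gcoef_nat:
  assumes "b' \<in> VZ a m" "u \<in> VZ a m" and k: "\<And>j. j \<in> {1..m} \<Longrightarrow> co j u = co j b' + real (k j)"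
  shows "gcoef a m l b' u
       = (\<Prod>j\<in>{1..m}. (\<Prod>i<k j. - complex_of_real (co j b') - of_nat i) / of_int (l j) ^ k j)"
proof -
  have fl: "\<lfloor>co j b' - co j u\<rfloor> = - int (k j)" if "j \<in> {1..m}" for j
  proof -
    have "co j b' - co j u = of_int (- int (k j))" using k[OF that] by simp
    thus ?thesis by (simp only: floor_of_int)
  qed
  have "rvec u \<in> Vsp a m" using assms(2) by (simp add: VZ_def)
  moreover have "\<forall>j\<in>{1..m}. acoord a m b' j - acoord a m u j \<in> \<int> \<and> acoord a m b' j - acoord a m u j \<le> 0"
    using assms(1,2) k by (simp add: acoord_eq)
  ultimately have "gcoef a m l b' u = (\<Prod>j\<in>{1..m}.
              bracket (- complex_of_real (acoord a m b' j)) \<lfloor>acoord a m b' j - acoord a m u j\<rfloor>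
              * complex_of_int (l j) powi \<lfloor>acoord a m b' j - acoord a m u j\<rfloor>)"
    unfolding gcoef_def by (intro if_P conjI)
  also have "\<dots> = (\<Prod>j\<in>{1..m}. (\<Prod>i<k j. - complex_of_real (co j b') - of_nat i) / of_int (l j) ^ k j)"
    using assms(1,2)
    by (intro prod.cong) (simp_all add: acoord_eq fl bracket_neg_nat power_int_minus divide_inverse)
  finally show ?thesis .
qed

lemma int_aboveE:
  assumes "int_above b' u"
  obtains k where "\<And>j. j \<in> {1..m} \<Longrightarrow> co j u = co j b' + real (k j)"
proof -
  have "\<forall>j\<in>{1..m}. \<exists>n. co j u - co j b' = real n"
    using assms unfolding int_above_def by (auto elim!: Nats_cases)
  then obtain k where k: "\<And>j. j \<in> {1..m} \<Longrightarrow> co j u - co j b' = real (k j)" by metis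
  have "co j u = co j b' + real (k j)" if "j \<in> {1..m}" for j using k[OF that] by linarith
  thus ?thesis by (rule that)
qed

text \<open>Raising n_k by one appends the factor (- v_k - n_k) / l_k, and v_k + n_k is the k-th
  coordinate of u. Off the support both terms are zero, because a step along a_k inside the cone
  cannot enter the support.\<close>

lemma gcoef_step:
  assumes b': "b' \<in> Bset a m" and u: "u \<in> Mset a m" and k: "k \<in> {1..m}"
  shows "of_real (co k u) * gcoef a m l b' u + of_int (l k) * gcoef a m l b' (u + a k) = 0"
proof (cases "int_above b' u")
  case True
  have V: "b' \<in> VZ a m" "u \<in> VZ a m" "u + a k \<in> VZ a m"
    using b' u k by (auto simp: Bset_iff Mset_iff VZ_add a_in_VZ)
  obtain n where n: "\<And>j. j \<in> {1..m} \<Longrightarrow> co j u = co j b' + real (n j)"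
    using int_aboveE[OF True] by blast
  define n' where "n' = n(k := Suc (n k))"
  have n': "co j (u + a k) = co j b' + real (n' j)" if "j \<in> {1..m}" for j
    using n[OF that] that k by (auto simp: co_add co_a n'_def)
  let ?f = "\<lambda>n j. (\<Prod>i<n j. - complex_of_real (co j b') - of_nat i) / of_int (l j) ^ n j"
  have lk: "complex_of_int (l k) \<noteq> 0" using l_pos[OF k] by (simp del: l_pos)
  have "of_int (l k) * ?f n' k = - of_real (co k u) * ?f n k"
    using lk by (simp add: n'_def n[OF k] field_simps)
  moreover have "gcoef a m l b' u = ?f n k * (\<Prod>j\<in>{1..m} - {k}. ?f n j)"
    using gcoef_nat[OF V(1,2) n] k by (simp add: prod.remove)
  moreover have "gcoef a m l b' (u + a k) = ?f n' k * (\<Prod>j\<in>{1..m} - {k}. ?f n j)"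
  proof -
    have "(\<Prod>j\<in>{1..m} - {k}. ?f n' j) = (\<Prod>j\<in>{1..m} - {k}. ?f n j)"
      by (intro prod.cong) (auto simp: n'_def)
    thus ?thesis using gcoef_nat[OF V(1,3) n'] k by (simp add: prod.remove)
  qed
  ultimately show ?thesis by (simp only: mult.assoc[symmetric]) simp
next
  case False
  have "\<not> int_above b' (u + a k)"
  proof
    assume A: "int_above b' (u + a k)"
    have "co j u - co j b' \<in> \<nat>" if j: "j \<in> {1..m}" for j
    proof (cases "j = k")
      case True
      have "co k (u + a k) - co k b' \<in> \<nat>" using A k by (simp add: int_above_def)
      then obtain n where n: "co k (u + a k) - co k b' = real n" by (rule Nats_cases)
      hence n1: "co k u - co k b' = real n - 1" using k by (simp add: co_add co_a)
      \<comment> \<open>Nonnegativity of the coordinate together with v_k < 1 excludes n = 0, so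
        \<open>u\<close> would already lie in the support.\<close>
      moreover have "co k u \<ge> 0" "co k b' < 1" using b' u k by (auto simp: Bset_iff Mset_iff)
      ultimately have "n \<ge> 1" by linarith
      hence "co k u - co k b' = real (n - 1)" using n1 by (simp add: of_nat_diff)
      thus ?thesis using True by simp
    next
      case False
      have "co j (u + a k) - co j b' \<in> \<nat>" using A j by (simp add: int_above_def)
      thus ?thesis using False j k by (simp add: co_add co_a)
    qed
    thus False using False by (simp add: int_above_def)
  qed
  thus ?thesis using False b' u k
    by (simp add: gcoef_0 Bset_iff Mset_iff VZ_add a_in_VZ)
qed

text \<open>A factor - v_j - i is zero only for v_j = 0 and i = 0, that is, when the coordinate of u
  is integral and at least one factor is present. The second condition no longer mentions b', so
  vanishing is decided by u alone once u and b' are congruent.\<close>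

lemma gcoef_nonzero_iff:
  assumes b': "b' \<in> Bset a m" and u: "u \<in> Mset a m"
  shows "gcoef a m l b' u \<noteq> 0 \<longleftrightarrow>
    (\<forall>j\<in>{1..m}. co j u - co j b' \<in> \<int>) \<and> (\<forall>j\<in>{1..m}. \<not> (co j u \<in> \<int> \<and> 1 \<le> co j u))"
proof (cases "int_above b' u")
  case True
  have V: "b' \<in> VZ a m" "u \<in> VZ a m" using b' u by (auto simp: Bset_iff Mset_iff)
  obtain n where n: "\<And>j. j \<in> {1..m} \<Longrightarrow> co j u = co j b' + real (n j)"
    using int_aboveE[OF True] by blast
  have I: "\<forall>j\<in>{1..m}. co j u - co j b' \<in> \<int>" using n by simp
  have "(\<Prod>i<n j. - complex_of_real (co j b') - of_nat i) / of_int (l j) ^ n j \<noteq> 0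
      \<longleftrightarrow> \<not> (co j u \<in> \<int> \<and> 1 \<le> co j u)" if j: "j \<in> {1..m}" for j
  proof -
    have lj: "l j \<noteq> 0" using l_pos[OF j] by linarith
    have c: "0 \<le> co j b'" "co j b' < 1" using b' j by (auto simp: Bset_iff)
    have "- complex_of_real (co j b') - of_nat i = 0 \<longleftrightarrow> co j b' = 0 \<and> i = 0" for i
    proof -
      have "- complex_of_real (co j b') - of_nat i = of_real (- co j b' - real i)" by simp
      hence "- complex_of_real (co j b') - of_nat i = 0 \<longleftrightarrow> - co j b' - real i = 0"
        by (simp only: of_real_eq_0_iff)
      thus ?thesis using c by auto
    qed
    hence "(\<Prod>i<n j. - complex_of_real (co j b') - of_nat i) = 0 \<longleftrightarrow> n j > 0 \<and> co j b' = 0"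
      by (auto simp: prod_zero_iff)
    moreover have "co j u \<in> \<int> \<longleftrightarrow> co j b' = 0"
    proof
      assume "co j u \<in> \<int>"
      hence "co j u - real (n j) \<in> \<int>" by (intro Ints_diff) auto
      hence "co j b' \<in> \<int>" using n[OF j] by simp
      thus "co j b' = 0" using frac_eq_less_1[of "co j b'" 0] c by simp
    qed (simp add: n[OF j])
    moreover have "co j b' = 0 \<Longrightarrow> 1 \<le> co j u \<longleftrightarrow> n j > 0" using n[OF j] by auto
    ultimately show ?thesis using lj by auto
  qed
  thus ?thesis using I gcoef_nat[OF V n] by (simp add: prod_zero_iff)
next
  case False
  have "\<not> (\<forall>j\<in>{1..m}. co j u - co j b' \<in> \<int>)"
  proof
    assume *: "\<forall>j\<in>{1..m}. co j u - co j b' \<in> \<int>"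
    have "co j u - co j b' \<in> \<nat>" if j: "j \<in> {1..m}" for j
    proof -
      obtain z where z: "co j u - co j b' = of_int z" using bspec[OF * j] by (auto elim!: Ints_cases)
      have "co j u \<ge> 0" "co j b' < 1" using b' u j by (auto simp: Bset_iff Mset_iff)
      hence "z \<ge> 0" using z by linarith
      thus ?thesis using z by (simp add: Nats_altdef2)
    qed
    thus False using False by (simp add: int_above_def)
  qed
  moreover have "gcoef a m l b' u = 0" using False b' u by (simp add: gcoef_0 Bset_iff Mset_iff)
  ultimately show ?thesis by blast
qed

text \<open>Coordinates in [0,1) that differ by integers are equal. This is the identity matrix at
  \<lambda> = 0.\<close>

lemma gcoef_Bset:
  assumes "b' \<in> Bset a m" "b'' \<in> Bset a m"
  shows "gcoef a m l b' b'' = (if b' = b'' then 1 else 0)"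
proof (cases "b' = b''")
  case True
  have "gcoef a m l b' b' = 1"
    using gcoef_nat[of b' b' "\<lambda>_. 0"] assms by (simp add: Bset_iff)
  thus ?thesis using True by simp
next
  case False
  have "gcoef a m l b' b'' = 0"
  proof (rule ccontr)
    assume "gcoef a m l b' b'' \<noteq> 0"
    hence i: "\<forall>j\<in>{1..m}. co j b'' - co j b' \<in> \<int>"
      using gcoef_nonzero_iff[of b' b''] assms Bset_subset_Mset by blast
    have "b'' = b'"
    proof (rule VZ_eqI)
      fix j assume "j \<in> {1..m}"
      thus "co j b'' = co j b'" using i assms by (intro frac_eq_less_1) (auto simp: Bset_iff)
    qed (use assms in \<open>auto simp: Bset_iff\<close>)
    thus False using False by simp
  qed
  thus ?thesis using False by simp
qed

lemma Mset_add_a_smult: "u \<in> Mset a m \<Longrightarrow> k \<in> {1..m} \<Longrightarrow> u + int n *s a k \<in> Mset a m"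
  by (auto simp: Mset_iff co_add co_smult VZ_add VZ_smult a_in_VZ co_a)

lemma Mset_add_a0_smult: "u \<in> Mset a m \<Longrightarrow> u + int n *s a0 \<in> Mset a m"
  using less_imp_le[OF co_a0_pos] by (simp add: Mset_iff co_add co_smult VZ_add VZ_smult a0_in_VZ)

lemma gcoef_add_a_smult:
  assumes b': "b' \<in> Bset a m" and u: "u \<in> Mset a m" and k: "k \<in> {1..m}"
  shows "gcoef a m l b' (u + int n *s a k)
       = gcoef a m l b' u * (\<Prod>i<n. - (of_real (co k u) + of_nat i) / of_int (l k))"
proof (induction n)
  case (Suc n)
  have lk: "complex_of_int (l k) \<noteq> 0" using l_pos[OF k] by (simp del: l_pos)
  let ?w = "u + int n *s a k"
  have e1: "u + int (Suc n) *s a k = ?w + a k" by (simp add: vector_sadd_rdistrib algebra_simps)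
  have e2: "of_int (l k) * gcoef a m l b' (?w + a k) = - of_real (co k ?w) * gcoef a m l b' ?w"
    using gcoef_step[OF b' Mset_add_a_smult[OF u k, of n] k] by (simp add: add_eq_0_iff)
  have e3: "co k ?w = co k u + real n" using k by (simp add: co_add co_smult co_a)
  have "of_int (l k) * gcoef a m l b' (u + int (Suc n) *s a k)
      = - (of_real (co k u) + of_nat n) * gcoef a m l b' ?w" by (simp only: e1 e2 e3) simp
  hence "gcoef a m l b' (u + int (Suc n) *s a k)
      = - (of_real (co k u) + of_nat n) / of_int (l k) * gcoef a m l b' ?w"
    using lk by (simp add: field_simps)
  thus ?case using Suc by simp
qed simp

text \<open>Moves along different a_j do not disturb each other's coordinates, so their factors
  multiply. For \<open>J = {1..m}\<close> the total shift is l_0 a_0.\<close>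

lemma gcoef_add_lincomb:
  assumes b': "b' \<in> Bset a m" and u: "u \<in> Mset a m" and J: "J \<subseteq> {1..m}"
  shows "u + (\<Sum>j\<in>J. l j *s a j) \<in> Mset a m \<and> gcoef a m l b' (u + (\<Sum>j\<in>J. l j *s a j))
       = gcoef a m l b' u * (\<Prod>j\<in>J. \<Prod>i<nat (l j). - (of_real (co j u) + of_nat i) / of_int (l j))"
proof -
  have "finite J" using J finite_subset by blast
  thus ?thesis using J
  proof (induction J rule: finite_induct)
    case (insert k J)
    have k: "k \<in> {1..m}" using insert.prems by simp
    let ?w = "u + (\<Sum>j\<in>J. l j *s a j)"
    have w: "?w \<in> Mset a m" using insert by simp
    have e: "u + (\<Sum>j\<in>insert k J. l j *s a j) = ?w + int (nat (l k)) *s a k"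
      using insert.hyps l_pos[OF k] by (simp add: algebra_simps del: l_pos)
    have "co k ?w = co k u + (\<Sum>j\<in>J. co k (l j *s a j))" using k by (simp add: co_add co_sum)
    also have "(\<Sum>j\<in>J. co k (l j *s a j)) = 0"
    proof (intro sum.neutral ballI)
      fix j assume j: "j \<in> J"
      hence "j \<in> {1..m}" "j \<noteq> k" using insert.hyps insert.prems by auto
      thus "co k (l j *s a j) = 0" using k by (simp add: co_smult co_a)
    qed
    finally have "co k ?w = co k u" by simp
    thus ?case unfolding e using gcoef_add_a_smult[OF b' w k, of "nat (l k)"] insert
      Mset_add_a_smult[OF w k, of "nat (l k)"] by (simp add: mult.assoc mult.commute)
  qed (use u in simp)
qed

section \<open>Differential and linear relations between the series\<close>

lemma Gser_nth: "fps_nth (Gser a a0 m l b' u) s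
    = gcoef a m l b' (u + int s *s a0) * (- of_int (l 0)) ^ s / of_nat (fact s)"
  by (simp add: Gser_def)

text \<open>Differentiation shifts the summation index, that is, it moves u by a_0; this matches the
  term - l_0 x^{a_0} of D_\<lambda>.\<close>

lemma fps_deriv_Gser:
  "fps_deriv (Gser a a0 m l b' u) = fps_const (- of_int (l 0)) * Gser a a0 m l b' (u + a0)"
proof (rule fps_ext)
  fix s
  let ?z = "- complex_of_int (l 0)" and ?g = "gcoef a m l b' (u + a0 + int s *s a0)"
  have e: "u + int (Suc s) *s a0 = u + a0 + int s *s a0"
    by (simp add: vector_sadd_rdistrib algebra_simps)
  have "fps_nth (fps_deriv (Gser a a0 m l b' u)) s
      = ?g * (of_nat (Suc s) * (?z ^ Suc s / of_nat (fact (Suc s))))"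
    unfolding fps_deriv_nth Suc_eq_plus1[symmetric] Gser_nth e by (simp only: ac_simps times_divide_eq_right)
  also have "\<dots> = fps_nth (fps_const ?z * Gser a a0 m l b' (u + a0)) s"
    unfolding Suc_mult_power_fact by (simp add: Gser_nth)
  finally show "fps_nth (fps_deriv (Gser a a0 m l b' u)) s
      = fps_nth (fps_const ?z * Gser a a0 m l b' (u + a0)) s" .
qed

text \<open>This is the vanishing of the functional on D_i x^u. In degree s, with w = u + s a_0, the
  sum over j equals - w_i times g_w by \<open>gcoef_step\<close>, while the first and last terms
  contribute u_i + s (a_0)_i = w_i.\<close>

lemma Gser_relation:
  assumes b': "b' \<in> Bset a m" and u: "u \<in> Mset a m"
  shows "fps_const (of_int (u $ i)) * Gser a a0 m l b' u
       + (\<Sum>j\<in>{1..m}. fps_const (of_int (l j * (a j $ i))) * Gser a a0 m l b' (u + a j))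
       - fps_const (of_int (l 0 * (a0 $ i))) * fps_X * Gser a a0 m l b' (u + a0) = 0"
proof (rule fps_ext)
  fix s
  define w where "w = u + int s *s a0"
  define q where "q = (\<lambda>s. (- of_int (l 0)) ^ s / (of_nat (fact s) :: complex))"
  define g where "g = gcoef a m l b'"
  have w: "w \<in> Mset a m" unfolding w_def using Mset_add_a0_smult[OF u] .
  have nth: "fps_nth (Gser a a0 m l b' v) s = g (v + int s *s a0) * q s" for v s
    by (simp add: Gser_nth g_def q_def)
  have wi: "complex_of_int (w $ i) = (\<Sum>j\<in>{1..m}. of_real (co j w) * of_int (a j $ i))"
  proof -
    have "rvec w $ i = (\<Sum>j\<in>{1..m}. co j w *\<^sub>R rvec (a j)) $ i"
      using VZ_expand[of w] w by (simp add: Mset_iff)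
    hence "real_of_int (w $ i) = (\<Sum>j\<in>{1..m}. co j w * of_int (a j $ i))"
      by (simp add: rvec_def)
    hence "complex_of_real (real_of_int (w $ i)) = complex_of_real (\<Sum>j\<in>{1..m}. co j w * of_int (a j $ i))"
      by (rule arg_cong)
    thus ?thesis by simp
  qed
  have "(\<Sum>j\<in>{1..m}. of_int (l j * (a j $ i)) * g (w + a j)) = - (of_int (w $ i) * g w)"
  proof -
    have "of_int (l j * (a j $ i)) * g (w + a j) = - (of_real (co j w) * of_int (a j $ i) * g w)"
      if "j \<in> {1..m}" for j
    proof -
      have "of_int (l j) * g (w + a j) = - (of_real (co j w) * g w)"
        using gcoef_step[OF b' w that] unfolding g_def by (simp add: add_eq_0_iff)
      hence "of_int (a j $ i) * (of_int (l j) * g (w + a j)) = of_int (a j $ i) * - (of_real (co j w) * g w)"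
        by (rule arg_cong)
      thus ?thesis by (simp add: ac_simps)
    qed
    thus ?thesis unfolding wi by (simp add: sum_negf sum_distrib_right)
  qed
  moreover have "fps_nth (\<Sum>j\<in>{1..m}. fps_const (of_int (l j * (a j $ i))) * Gser a a0 m l b' (u + a j)) s
      = (\<Sum>j\<in>{1..m}. of_int (l j * (a j $ i)) * g (w + a j)) * q s"
    unfolding fps_sum_nth sum_distrib_right
    by (intro sum.cong) (simp_all add: nth w_def add.commute add.left_commute)
  ultimately have 2: "fps_nth (\<Sum>j\<in>{1..m}. fps_const (of_int (l j * (a j $ i))) * Gser a a0 m l b' (u + a j)) s
      = - (of_int (w $ i) * g w) * q s" by simp
  have 3: "fps_nth (fps_const (of_int (l 0 * (a0 $ i))) * fps_X * Gser a a0 m l b' (u + a0)) s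
     = - (of_nat s * of_int (a0 $ i)) * g w * q s"
  proof (cases s)
    case (Suc t)
    \<comment> \<open>The factor \<open>fps_X\<close> lowers the index to t = s - 1 and the extra
      a_0 restores the exponent w; the quotient of the factorials supplies the factor s.\<close>
    have e: "u + a0 + int t *s a0 = w" by (simp add: w_def Suc vector_sadd_rdistrib algebra_simps)
    have "of_nat (Suc t) * q (Suc t) = - of_int (l 0) * q t"
      unfolding q_def by (rule Suc_mult_power_fact)
    hence "(of_int (a0 $ i) * g w) * (of_nat s * q s) = (of_int (a0 $ i) * g w) * (- of_int (l 0) * q t)"
      by (simp only: Suc)
    moreover have "fps_nth (fps_const (of_int (l 0 * (a0 $ i))) * fps_X * Gser a a0 m l b' (u + a0)) s
      = of_int (l 0 * (a0 $ i)) * g w * q t"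
      by (simp add: mult.assoc Suc nth e)
    ultimately show ?thesis by (simp add: ac_simps)
  qed (simp add: mult.assoc)
  have wi': "of_int (w $ i) = (of_int (u $ i) + of_nat s * of_int (a0 $ i) :: complex)"
    by (simp add: w_def)
  show "fps_nth (fps_const (of_int (u $ i)) * Gser a a0 m l b' u
       + (\<Sum>j\<in>{1..m}. fps_const (of_int (l j * (a j $ i))) * Gser a a0 m l b' (u + a j))
       - fps_const (of_int (l 0 * (a0 $ i))) * fps_X * Gser a a0 m l b' (u + a0)) s = fps_nth 0 s"
    unfolding fps_sub_nth fps_add_nth 2 3
    by (simp add: nth w_def[symmetric] wi' algebra_simps)
qed

end

section \<open>The solution functionals\<close>

lemma Di_add: "Di a a0 m l i (\<lambda>u. h u + k u) u = Di a a0 m l i h u + Di a a0 m l i k u"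
  by (simp add: Di_def algebra_simps sum.distrib)

lemma Di_scale: "Di a a0 m l i (\<lambda>u. c * h u) u = c * Di a a0 m l i h u"
  by (simp add: Di_def algebra_simps sum_distrib_left)

lemma Sk_0: "(\<lambda>_. 0) \<in> Sk M"
  by (simp add: Sk_def)

lemma Sk_add: "h \<in> Sk M \<Longrightarrow> k \<in> Sk M \<Longrightarrow> (\<lambda>u. h u + k u) \<in> Sk M"
proof -
  assume hk: "h \<in> Sk M" "k \<in> Sk M"
  have "{u. h u + k u \<noteq> 0} \<subseteq> {u. h u \<noteq> 0} \<union> {u. k u \<noteq> 0}" by auto
  thus ?thesis using hk unfolding Sk_def by (auto intro: finite_subset)
qed

lemma Sk_scale: "h \<in> Sk M \<Longrightarrow> (\<lambda>u. c * h u) \<in> Sk M"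
  unfolding Sk_def by (auto intro: finite_subset[of _ "{u. h u \<noteq> 0}"])

lemma Sk_sum: "(\<And>i. i \<in> I \<Longrightarrow> h i \<in> Sk M) \<Longrightarrow> (\<lambda>u. \<Sum>i\<in>I. h i u) \<in> Sk M"
  by (induction I rule: infinite_finite_induct) (auto simp: Sk_0 Sk_add)

lemma Sk_monom: "b \<in> M \<Longrightarrow> monom b \<in> Sk M"
  by (auto simp: Sk_def monom_def)

lemma finite_shift:
  fixes h :: "int ^ 'n \<Rightarrow> ratfun"
  assumes "finite {u. h u \<noteq> 0}"
  shows "finite {u. h (u - v) \<noteq> 0}"
proof -
  have "{u. h (u - v) \<noteq> 0} = (\<lambda>u. u + v) ` {u. h u \<noteq> 0}"
    by (auto simp: image_iff intro!: exI[of _ "_ - v"])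
  thus ?thesis using assms by simp
qed

lemma Sk_shift:
  assumes "h \<in> Sk M" "\<And>u. u \<in> M \<Longrightarrow> u + v \<in> M"
  shows "(\<lambda>u. h (u - v)) \<in> Sk M"
proof -
  have "u \<in> M" if "h (u - v) \<noteq> 0" for u
    using assms(2)[of "u - v"] assms(1) that by (auto simp: Sk_def)
  thus ?thesis using assms(1) finite_shift[of h v] by (auto simp: Sk_def)
qed

text \<open>Being a C(\<lambda>)-subspace of the space of coefficient functions.\<close>

definition lin_closed :: "(int ^ 'n \<Rightarrow> ratfun) set \<Rightarrow> bool" where
  "lin_closed S \<longleftrightarrow> (\<lambda>_. 0) \<in> S \<and> (\<forall>h\<in>S. \<forall>k\<in>S. (\<lambda>u. h u + k u) \<in> S)
     \<and> (\<forall>c. \<forall>h\<in>S. (\<lambda>u. c * h u) \<in> S)"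

lemma lin_closed_add: "lin_closed S \<Longrightarrow> h \<in> S \<Longrightarrow> k \<in> S \<Longrightarrow> (\<lambda>u. h u + k u) \<in> S"
  by (simp add: lin_closed_def)

lemma lin_closed_scale: "lin_closed S \<Longrightarrow> h \<in> S \<Longrightarrow> (\<lambda>u. c * h u) \<in> S"
  by (simp add: lin_closed_def)

lemma lin_closed_sum:
  "lin_closed S \<Longrightarrow> (\<And>i. i \<in> I \<Longrightarrow> h i \<in> S) \<Longrightarrow> (\<lambda>u. \<Sum>i\<in>I. h i u) \<in> S"
  by (induction I rule: infinite_finite_induct) (auto simp: lin_closed_def)

lemma DiImage_lin_closed: "lin_closed (DiImage a a0 m l M)"
  unfolding lin_closed_def
proof (intro conjI ballI allI)
  have "(\<lambda>u. \<Sum>i\<in>UNIV. Di a a0 m l i (\<lambda>_. 0) u) = (\<lambda>_. 0)" by (simp add: Di_def)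
  thus "(\<lambda>_. 0) \<in> DiImage a a0 m l M"
    unfolding DiImage_def by (intro CollectI exI[of _ "\<lambda>_ _. 0"]) (simp add: Sk_0)
next
  fix h k assume "h \<in> DiImage a a0 m l M" "k \<in> DiImage a a0 m l M"
  then obtain hs ks where "\<forall>i. hs i \<in> Sk M" "h = (\<lambda>u. \<Sum>i\<in>UNIV. Di a a0 m l i (hs i) u)"
    "\<forall>i. ks i \<in> Sk M" "k = (\<lambda>u. \<Sum>i\<in>UNIV. Di a a0 m l i (ks i) u)"
    unfolding DiImage_def by blast
  thus "(\<lambda>u. h u + k u) \<in> DiImage a a0 m l M"
    unfolding DiImage_def
    by (intro CollectI exI[of _ "\<lambda>i u. hs i u + ks i u"]) (simp add: Sk_add Di_add sum.distrib)
next
  fix c h assume "h \<in> DiImage a a0 m l M"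
  then obtain hs where "\<forall>i. hs i \<in> Sk M" "h = (\<lambda>u. \<Sum>i\<in>UNIV. Di a a0 m l i (hs i) u)"
    unfolding DiImage_def by blast
  thus "(\<lambda>u. c * h u) \<in> DiImage a a0 m l M"
    unfolding DiImage_def
    by (intro CollectI exI[of _ "\<lambda>i u. c * hs i u"]) (simp add: Sk_scale Di_scale sum_distrib_left)
qed

locale lattice_coset = lattice_relation a a0 m l
  for a :: "nat \<Rightarrow> int ^ 'n" and a0 m l +
  fixes C :: "(int ^ 'n) set"
  assumes coset: "is_coset a a0 m C"
begin

definition MC :: "(int ^ 'n) set" where "MC = Mset a m \<inter> C"

definition BC :: "(int ^ 'n) set" where "BC = Bset a m \<inter> C"

lemma BC_subset_MC: "BC \<subseteq> MC"
  using Bset_subset_Mset by (auto simp: BC_def MC_def)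

lemma MC_add_a0: "u \<in> MC \<Longrightarrow> u + a0 \<in> MC"
  using coset_add_a0[OF coset] Mset_add_a0 by (auto simp: MC_def)

lemma MC_add_a: "u \<in> MC \<Longrightarrow> j \<in> {1..m} \<Longrightarrow> u + a j \<in> MC"
  using coset_add_a_smult[OF coset, of u j 1] Mset_add_a by (auto simp: MC_def)

lemma finite_BC: "finite BC"
proof (rule finite_subset)
  show "BC \<subseteq> {u \<in> Mset a m. wt u \<le> real m}"
  proof
    fix u assume u: "u \<in> BC"
    have "wt u \<le> (\<Sum>j\<in>{1..m}. 1)" unfolding wt_def
      using u by (intro sum_mono) (auto simp: BC_def Bset_iff intro: less_imp_le)
    thus "u \<in> {u \<in> Mset a m. wt u \<le> real m}" using u Bset_subset_Mset by (auto simp: BC_def)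
  qed
qed (rule finite_Mset_wt)

text \<open>The values are Laurent series because the coefficients \<open>h u\<close> may have poles
  at 0.\<close>

definition phi :: "int ^ 'n \<Rightarrow> (int ^ 'n \<Rightarrow> ratfun) \<Rightarrow> complex fls" where
  "phi b' h = (\<Sum>u | h u \<noteq> 0. rat_to_fls (h u) * fps_to_fls (Gser a a0 m l b' u))"

lemma phi_superset:
  assumes "finite A" "{u. h u \<noteq> 0} \<subseteq> A"
  shows "phi b' h = (\<Sum>u\<in>A. rat_to_fls (h u) * fps_to_fls (Gser a a0 m l b' u))"
  unfolding phi_def using assms by (intro sum.mono_neutral_left) auto

lemma phi_sum:
  assumes "finite I" "\<And>i. i \<in> I \<Longrightarrow> finite {u. h i u \<noteq> 0}"
  shows "phi b' (\<lambda>u. \<Sum>i\<in>I. h i u) = (\<Sum>i\<in>I. phi b' (h i))"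
proof -
  define A where "A = (\<Union>i\<in>I. {u. h i u \<noteq> 0})"
  have A: "finite A" using assms by (simp add: A_def)
  have "{u. (\<Sum>i\<in>I. h i u) \<noteq> 0} \<subseteq> A"
    by (auto simp: A_def dest: sum.not_neutral_contains_not_neutral)
  hence "phi b' (\<lambda>u. \<Sum>i\<in>I. h i u)
      = (\<Sum>u\<in>A. rat_to_fls (\<Sum>i\<in>I. h i u) * fps_to_fls (Gser a a0 m l b' u))"
    by (rule phi_superset[OF A])
  also have "\<dots> = (\<Sum>i\<in>I. \<Sum>u\<in>A. rat_to_fls (h i u) * fps_to_fls (Gser a a0 m l b' u))"
    unfolding rat_to_fls_sum sum_distrib_right by (rule sum.swap)
  also have "\<dots> = (\<Sum>i\<in>I. phi b' (h i))"
    by (intro sum.cong refl phi_superset[OF A, symmetric]) (auto simp: A_def)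
  finally show ?thesis .
qed

lemma phi_add:
  assumes "finite {u. h u \<noteq> 0}" "finite {u. k u \<noteq> 0}"
  shows "phi b' (\<lambda>u. h u + k u) = phi b' h + phi b' k"
  using phi_sum[of "{True, False}" "\<lambda>i. if i then h else k"] assms by simp

lemma phi_scale: "phi b' (\<lambda>u. c * h u) = rat_to_fls c * phi b' h"
  by (cases "c = 0") (simp_all add: phi_def rat_to_fls_mult sum_distrib_left mult.assoc)

lemma phi_shift:
  "phi b' (\<lambda>u. h (u - v)) = (\<Sum>u | h u \<noteq> 0. rat_to_fls (h u) * fps_to_fls (Gser a a0 m l b' (u + v)))"
  unfolding phi_def
  by (rule sum.reindex_bij_witness[of _ "\<lambda>u. u + v" "\<lambda>u. u - v"]) auto

text \<open>Moving the shifts from \<open>h\<close> to the series turns the value into a sum over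
  the support of \<open>h\<close> in which each summand is a multiple of
  \<open>Gser_relation\<close>.\<close>

lemma phi_Di:
  assumes b': "b' \<in> Bset a m" and h: "h \<in> Sk MC"
  shows "phi b' (Di a a0 m l i h) = 0"
proof -
  let ?S = "{u. h u \<noteq> 0}" and ?R = "\<lambda>u. rat_to_fls (h u)"
  let ?G = "\<lambda>u. fps_to_fls (Gser a a0 m l b' u)" and ?c = "\<lambda>z. fls_const (complex_of_int z)"
  have S: "finite ?S" and SM: "?S \<subseteq> MC" using h by (auto simp: Sk_def)
  define T where "T = (\<lambda>j u. of_int (l j * (a j $ i)) * h (u - a j))"
  have finT: "finite {u. T j u \<noteq> 0}" for j
    by (rule finite_subset[OF _ finite_shift[OF S, of "a j"]]) (auto simp: T_def)
  have fin1: "finite {u. of_int (u $ i) * h u \<noteq> 0}"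
    by (rule finite_subset[OF _ S]) auto
  have fin3: "finite {u. - (of_int (l 0 * (a0 $ i)) * lam) * h (u - a0) \<noteq> 0}"
    by (rule finite_subset[OF _ finite_shift[OF S, of a0]]) auto
  have fin2: "finite {u. (\<Sum>j\<in>{1..m}. T j u) \<noteq> 0}"
    by (rule finite_subset[of _ "\<Union>j\<in>{1..m}. {u. T j u \<noteq> 0}"])
      (auto simp: finT dest: sum.not_neutral_contains_not_neutral)
  have fin12: "finite {u. of_int (u $ i) * h u + (\<Sum>j\<in>{1..m}. T j u) \<noteq> 0}"
    by (rule finite_subset[OF _ finite_UnI[OF fin1 fin2]]) auto
  have p1: "phi b' (\<lambda>u. of_int (u $ i) * h u) = (\<Sum>u\<in>?S. ?R u * (?c (u $ i) * ?G u))"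
    using phi_superset[OF S, of "\<lambda>u. of_int (u $ i) * h u" b']
    by (auto simp: rat_to_fls_mult rat_to_fls_of_int ac_simps)
  have p2: "phi b' (\<lambda>u. \<Sum>j\<in>{1..m}. T j u)
      = (\<Sum>u\<in>?S. ?R u * (\<Sum>j\<in>{1..m}. ?c (l j * (a j $ i)) * ?G (u + a j)))"
  proof -
    have "phi b' (\<lambda>u. \<Sum>j\<in>{1..m}. T j u) = (\<Sum>j\<in>{1..m}. phi b' (T j))"
      by (rule phi_sum) (auto simp: finT)
    also have "\<dots> = (\<Sum>j\<in>{1..m}. \<Sum>u\<in>?S. ?R u * (?c (l j * (a j $ i)) * ?G (u + a j)))"
      unfolding T_def phi_scale phi_shift sum_distrib_left rat_to_fls_of_int
      by (simp only: ac_simps)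
    finally show ?thesis unfolding sum_distrib_left by (subst sum.swap)
  qed
  have p3: "phi b' (\<lambda>u. - (of_int (l 0 * (a0 $ i)) * lam) * h (u - a0))
      = (\<Sum>u\<in>?S. ?R u * (- (?c (l 0 * (a0 $ i)) * fls_X) * ?G (u + a0)))"
    unfolding phi_scale phi_shift sum_distrib_left rat_to_fls_of_int rat_to_fls_mult
      rat_to_fls_uminus rat_to_fls_lam
    by (simp only: ac_simps)
  have "Di a a0 m l i h
     = (\<lambda>u. (of_int (u $ i) * h u + (\<Sum>j\<in>{1..m}. T j u)) + - (of_int (l 0 * (a0 $ i)) * lam) * h (u - a0))"
    by (simp add: Di_def T_def)
  hence "phi b' (Di a a0 m l i h)
     = (\<Sum>u\<in>?S. ?R u * (?c (u $ i) * ?G u)) + (\<Sum>u\<in>?S. ?R u * (\<Sum>j\<in>{1..m}. ?c (l j * (a j $ i)) * ?G (u + a j)))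
     + (\<Sum>u\<in>?S. ?R u * (- (?c (l 0 * (a0 $ i)) * fls_X) * ?G (u + a0)))"
    by (simp only: phi_add[OF fin12 fin3] phi_add[OF fin1 fin2] p1 p2 p3)
  also have "\<dots> = (\<Sum>u\<in>?S. ?R u * (?c (u $ i) * ?G u + (\<Sum>j\<in>{1..m}. ?c (l j * (a j $ i)) * ?G (u + a j))
     + - (?c (l 0 * (a0 $ i)) * fls_X) * ?G (u + a0)))"
    by (simp only: sum.distrib distrib_left)
  also have "\<dots> = 0"
  proof (intro sum.neutral ballI)
    fix u assume "u \<in> ?S"
    hence u: "u \<in> Mset a m" using SM by (auto simp: MC_def)
    have "fps_to_fls (\<Sum>j\<in>{1..m}. F j) = (\<Sum>j\<in>{1..m}. fps_to_fls (F j))" for F :: "nat \<Rightarrow> complex fps"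
      by (induction m) auto
    hence "?c (u $ i) * ?G u + (\<Sum>j\<in>{1..m}. ?c (l j * (a j $ i)) * ?G (u + a j))
     + - (?c (l 0 * (a0 $ i)) * fls_X) * ?G (u + a0) = 0"
      using arg_cong[OF Gser_relation[OF b' u, of i], of fps_to_fls]
      by (simp add: fls_times_fps_to_fls fps_X_to_fls)
    thus "?R u * (?c (u $ i) * ?G u + (\<Sum>j\<in>{1..m}. ?c (l j * (a j $ i)) * ?G (u + a j))
     + - (?c (l 0 * (a0 $ i)) * fls_X) * ?G (u + a0)) = 0" by simp
  qed
  finally show ?thesis .
qed

lemma Di_in_Sk:
  assumes h: "h \<in> Sk MC" shows "Di a a0 m l i h \<in> Sk MC"
proof -
  have 1: "(\<lambda>u. of_int (u $ i) * h u) \<in> Sk MC"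
    using h unfolding Sk_def by (auto intro: finite_subset[of _ "{u. h u \<noteq> 0}"])
  have 2: "(\<lambda>u. \<Sum>j\<in>{1..m}. of_int (l j * (a j $ i)) * h (u - a j)) \<in> Sk MC"
    by (intro Sk_sum Sk_scale Sk_shift[OF h] MC_add_a)
  have 3: "(\<lambda>u. - (of_int (l 0 * (a0 $ i)) * lam) * h (u - a0)) \<in> Sk MC"
    by (intro Sk_scale Sk_shift[OF h] MC_add_a0)
  show ?thesis using Sk_add[OF Sk_add[OF 1 2] 3] by (simp add: Di_def[abs_def])
qed

lemma phi_DiImage:
  assumes b': "b' \<in> Bset a m" and "h \<in> DiImage a a0 m l MC"
  shows "h \<in> Sk MC" "phi b' h = 0"
proof -
  obtain hs where hs: "\<And>i. hs i \<in> Sk MC" and h: "h = (\<lambda>u. \<Sum>i\<in>UNIV. Di a a0 m l i (hs i) u)"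
    using assms(2) unfolding DiImage_def by blast
  show "h \<in> Sk MC" unfolding h by (intro Sk_sum Di_in_Sk hs)
  have "finite {u. Di a a0 m l i (hs i) u \<noteq> 0}" for i
    using Di_in_Sk[OF hs] by (simp add: Sk_def)
  hence "phi b' h = (\<Sum>i\<in>UNIV. phi b' (Di a a0 m l i (hs i)))"
    unfolding h by (intro phi_sum) auto
  thus "phi b' h = 0" by (simp add: phi_Di[OF b' hs])
qed

lemma Dlam_in_Sk: "h \<in> Sk MC \<Longrightarrow> Dlam a0 l h \<in> Sk MC"
proof -
  assume h: "h \<in> Sk MC"
  have "(\<lambda>u. rderiv (h u)) \<in> Sk MC"
    using h unfolding Sk_def by (auto intro: finite_subset[of _ "{u. h u \<noteq> 0}"])
  moreover have "(\<lambda>u. - of_int (l 0) * h (u - a0)) \<in> Sk MC"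
    by (intro Sk_scale Sk_shift[OF h] MC_add_a0)
  ultimately show ?thesis using Sk_add by (fastforce simp: Dlam_def[abs_def])
qed

text \<open>Leibniz rule: the derivative of the coefficients comes from the first half of
  D_\<lambda>, the derivative of the series from multiplication by - l_0 x^{a_0}.\<close>

lemma phi_Dlam:
  assumes h: "h \<in> Sk MC"
  shows "phi b' (Dlam a0 l h) = fls_deriv (phi b' h)"
proof -
  let ?S = "{u. h u \<noteq> 0}" and ?R = "\<lambda>u. rat_to_fls (h u)"
  let ?G = "\<lambda>u. fps_to_fls (Gser a a0 m l b' u)"
  have S: "finite ?S" using h by (auto simp: Sk_def)
  have fin1: "finite {u. rderiv (h u) \<noteq> 0}" by (rule finite_subset[OF _ S]) auto
  have fin2: "finite {u. - of_int (l 0) * h (u - a0) \<noteq> 0}"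
    by (rule finite_subset[OF _ finite_shift[OF S, of a0]]) auto
  have "Dlam a0 l h = (\<lambda>u. rderiv (h u) + - of_int (l 0) * h (u - a0))"
    by (simp add: Dlam_def)
  hence "phi b' (Dlam a0 l h) = phi b' (\<lambda>u. rderiv (h u)) + phi b' (\<lambda>u. - of_int (l 0) * h (u - a0))"
    by (simp only: phi_add[OF fin1 fin2])
  also have "phi b' (\<lambda>u. rderiv (h u)) = (\<Sum>u\<in>?S. fls_deriv (?R u) * ?G u)"
    unfolding rat_to_fls_rderiv[symmetric] by (rule phi_superset[OF S]) auto
  also have "phi b' (\<lambda>u. - of_int (l 0) * h (u - a0)) = (\<Sum>u\<in>?S. ?R u * fls_deriv (?G u))"
    unfolding phi_scale phi_shift sum_distrib_left rat_to_fls_uminus rat_to_fls_of_int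
      fls_deriv_fps_to_fls fps_deriv_Gser
    by (intro sum.cong) (simp_all add: fls_times_fps_to_fls)
  finally show ?thesis unfolding phi_def fls_deriv_sum fls_deriv_mult sum.distrib by (simp only: add.commute)
qed

lemma Dlam_pow_in_Sk: "h \<in> Sk MC \<Longrightarrow> (Dlam a0 l ^^ i) h \<in> Sk MC"
  by (induction i) (auto simp: Dlam_in_Sk)

lemma phi_monom: "phi b' (monom b) = fps_to_fls (Gser a a0 m l b' b)"
  by (subst phi_superset[of "{b}"]) (auto simp: monom_def)

lemma phi_Dlam_pow_monom:
  assumes "b \<in> MC"
  shows "phi b' ((Dlam a0 l ^^ i) (monom b)) = fps_to_fls ((fps_deriv ^^ i) (Gser a a0 m l b' b))"
  using Dlam_pow_in_Sk[OF Sk_monom[OF assms]]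
  by (induction i) (simp_all add: phi_monom phi_Dlam fls_deriv_fps_to_fls)

end

section \<open>Reduction to monomials in the fundamental parallelepiped\<close>

context lattice_coset
begin

text \<open>Writes a coordinate through the standard components; the coefficients become the
  multipliers of the D_i in \<open>monom_relation\<close>.\<close>

lemma co_expand:
  assumes "j \<in> {1..m}"
  shows "co j u = (\<Sum>i\<in>UNIV. of_int (u $ i) * dual j (axis i 1))"
proof -
  have "rvec u = (\<Sum>i\<in>UNIV. (rvec u $ i) *\<^sub>R axis i 1)"
    using basis_expansion[of "rvec u"] by (simp add: scalar_mult_eq_scaleR)
  hence "co j u = dual j (\<Sum>i\<in>UNIV. (rvec u $ i) *\<^sub>R axis i 1)" by (simp add: co_def)
  also have "\<dots> = (\<Sum>i\<in>UNIV. of_int (u $ i) * dual j (axis i 1))"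
    by (simp add: linear_sum[OF linear_dual[OF assms]] linear_scale[OF linear_dual[OF assms]] rvec_def)
  finally show ?thesis .
qed

text \<open>The operator \<open>\<Sum>\<^sub>i \<xi>\<^sub>i D\<^sub>i\<close>, for \<open>\<xi>\<close> the linear form dual to \<open>a\<^sub>j\<close>, involves \<open>a\<^sub>j\<close> and \<open>a\<^sub>0\<close> only.\<close>

lemma monom_relation:
  assumes v: "v \<in> MC" and j: "j \<in> {1..m}"
  shows "(\<lambda>u. constR (of_real (co j v)) * monom v u + of_int (l j) * monom (v + a j) u
      + - (of_int (l j) * lam) * monom (v + a0) u) \<in> DiImage a a0 m l MC"
proof -
  define F where "F = (\<lambda>i. constR (of_real (dual j (axis i 1))))"
  define hs where "hs = (\<lambda>i u. F i * monom v u)"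
  have X: "(\<Sum>i\<in>UNIV. of_int (w $ i) * F i) = constR (of_real (co j w))" for w
    by (simp add: F_def co_expand[OF j] constR_sum constR_mult constR_of_int)
  have shift: "monom v (u - w) = monom (v + w) u" for u w
    by (auto simp: monom_def algebra_simps)
  \<comment> \<open>Because of l_0 co_j(a_0) = l_j, the terms of a_j and a_0 carry the same
    constant, so dividing by it leaves exactly \<lambda>.\<close>
  have X0: "of_int (l 0) * constR (of_real (co j a0)) = of_int (l j)"
  proof -
    have "complex_of_int (l 0) * of_real (co j a0) = of_int (l j)"
      using l0_pos by (simp add: co_a0[OF j] del: l0_pos)
    thus ?thesis by (metis constR_mult constR_of_int)
  qed
  have "(\<Sum>i\<in>UNIV. Di a a0 m l i (hs i) u) =
     constR (of_real (co j v)) * monom v u + of_int (l j) * monom (v + a j) u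
      + - (of_int (l j) * lam) * monom (v + a0) u" for u
  proof -
    have 1: "(\<Sum>i\<in>UNIV. of_int (u $ i) * hs i u) = constR (of_real (co j v)) * monom v u"
    proof (cases "u = v")
      case True
      thus ?thesis unfolding X[symmetric] by (simp add: hs_def monom_def)
    qed (simp add: hs_def monom_def)
    have "(\<Sum>i\<in>UNIV. \<Sum>k\<in>{1..m}. of_int (l k * (a k $ i)) * hs i (u - a k))
      = (\<Sum>k\<in>{1..m}. of_int (l k) * (\<Sum>i\<in>UNIV. of_int (a k $ i) * F i) * monom (v + a k) u)"
      unfolding hs_def shift
      by (subst sum.swap) (simp add: sum_distrib_left sum_distrib_right mult.assoc)
    also have "\<dots> = (\<Sum>k\<in>{1..m}. if k = j then of_int (l j) * monom (v + a j) u else 0)"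
      unfolding X using j by (intro sum.cong) (auto simp: co_a)
    finally have 2: "(\<Sum>i\<in>UNIV. \<Sum>k\<in>{1..m}. of_int (l k * (a k $ i)) * hs i (u - a k))
      = of_int (l j) * monom (v + a j) u" using j by simp
    have "(\<Sum>i\<in>UNIV. of_int (l 0 * (a0 $ i)) * lam * hs i (u - a0))
      = (of_int (l 0) * (\<Sum>i\<in>UNIV. of_int (a0 $ i) * F i)) * lam * monom (v + a0) u"
      unfolding hs_def shift
      by (simp add: sum_distrib_left sum_distrib_right ac_simps)
    hence 3: "(\<Sum>i\<in>UNIV. of_int (l 0 * (a0 $ i)) * lam * hs i (u - a0))
      = of_int (l j) * lam * monom (v + a0) u" unfolding X X0 .
    show ?thesis unfolding Di_def sum.distrib sum_subtractf 1 2 3 by simp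
  qed
  moreover have "hs i \<in> Sk MC" for i unfolding hs_def by (intro Sk_scale Sk_monom v)
  ultimately show ?thesis unfolding DiImage_def by (intro CollectI exI[of _ hs]) simp
qed

definition reducible :: "(int ^ 'n \<Rightarrow> ratfun) set" where
  "reducible = {h. \<exists>c d. d \<in> DiImage a a0 m l MC \<and> h = (\<lambda>u. (\<Sum>b\<in>BC. c b * monom b u) + d u)}"

lemma reducible_lin_closed: "lin_closed reducible"
proof -
  note D = DiImage_lin_closed[of a a0 m l MC]
  have "(\<lambda>_. 0) \<in> reducible" unfolding reducible_def
    using D by (intro CollectI exI[of _ "\<lambda>_. 0"]) (auto simp: lin_closed_def)
  moreover have "(\<lambda>u. h u + k u) \<in> reducible" if hk: "h \<in> reducible" "k \<in> reducible" for h k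
  proof -
    obtain c d c' d' where cd: "d \<in> DiImage a a0 m l MC" "h = (\<lambda>u. (\<Sum>b\<in>BC. c b * monom b u) + d u)"
      "d' \<in> DiImage a a0 m l MC" "k = (\<lambda>u. (\<Sum>b\<in>BC. c' b * monom b u) + d' u)"
      using hk unfolding reducible_def by blast
    show ?thesis unfolding reducible_def
      using lin_closed_add[OF D cd(1,3)] cd(2,4)
      by (intro CollectI exI[of _ "\<lambda>b. c b + c' b"] exI[of _ "\<lambda>u. d u + d' u"])
        (auto simp: algebra_simps sum.distrib)
  qed
  moreover have "(\<lambda>u. x * h u) \<in> reducible" if h: "h \<in> reducible" for h x
  proof -
    obtain c d where cd: "d \<in> DiImage a a0 m l MC" "h = (\<lambda>u. (\<Sum>b\<in>BC. c b * monom b u) + d u)"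
      using h unfolding reducible_def by blast
    show ?thesis unfolding reducible_def
      using lin_closed_scale[OF D cd(1)] cd(2)
      by (intro CollectI exI[of _ "\<lambda>b. x * c b"] exI[of _ "\<lambda>u. x * d u"])
        (auto simp: algebra_simps sum_distrib_left)
  qed
  ultimately show ?thesis by (simp add: lin_closed_def)
qed

lemmas reducible_add = lin_closed_add[OF reducible_lin_closed]
lemmas reducible_scale = lin_closed_scale[OF reducible_lin_closed]

lemma DiImage_reducible: "d \<in> DiImage a a0 m l MC \<Longrightarrow> d \<in> reducible"
  unfolding reducible_def by (intro CollectI exI[of _ "\<lambda>_. 0"] exI[of _ d]) simp

lemma BC_reducible:
  assumes "b \<in> BC" shows "monom b \<in> reducible"
proof -
  have "(\<Sum>b'\<in>BC. (if b' = b then 1 else 0) * monom b' u) = monom b u" for u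
  proof -
    have "(\<Sum>b'\<in>BC. (if b' = b then 1 else 0) * monom b' u) = (\<Sum>b'\<in>BC. if b' = b then monom b u else 0)"
      by (intro sum.cong) auto
    thus ?thesis using assms finite_BC by simp
  qed
  thus ?thesis unfolding reducible_def using DiImage_lin_closed[of a a0 m l MC]
    by (intro CollectI exI[of _ "\<lambda>b'. if b' = b then 1 else 0"] exI[of _ "\<lambda>_. 0"])
      (auto simp: lin_closed_def)
qed

section \<open>The exchange process and the spanning of the quotient\<close>

definition big_coord :: "int ^ 'n \<Rightarrow> nat" where
  "big_coord u = (SOME j. j \<in> {1..m} \<and> 1 \<le> co j u)"

definition exchange :: "int ^ 'n \<Rightarrow> int ^ 'n" where
  "exchange u = u - a (big_coord u) + a0"

lemma big_coord:
  assumes "u \<in> MC" "u \<notin> BC"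
  shows "big_coord u \<in> {1..m}" "1 \<le> co (big_coord u) u"
proof -
  have "\<exists>j. j \<in> {1..m} \<and> 1 \<le> co j u"
    using assms by (force simp: MC_def BC_def Mset_iff Bset_iff not_less)
  from someI_ex[OF this] show "big_coord u \<in> {1..m}" "1 \<le> co (big_coord u) u"
    by (simp_all add: big_coord_def)
qed

lemma lower_in_MC:
  assumes "u \<in> MC" "u \<notin> BC"
  shows "u - a (big_coord u) \<in> MC" "wt (u - a (big_coord u)) = wt u - 1"
proof -
  note j = big_coord[OF assms]
  have "u - a (big_coord u) \<in> C"
    using coset_add_a_smult[OF coset _ j(1), of u "-1"] assms
    by (simp add: MC_def vector_sneg_minus1[symmetric])
  moreover have "u - a (big_coord u) \<in> Mset a m"
    using assms j by (auto simp: MC_def Mset_iff VZ_diff a_in_VZ co_diff co_a)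
  ultimately show "u - a (big_coord u) \<in> MC" by (simp add: MC_def)
  show "wt (u - a (big_coord u)) = wt u - 1" using j by (simp add: wt_diff wt_a)
qed

lemma exchange_in_MC:
  assumes "u \<in> MC" "u \<notin> BC"
  shows "exchange u \<in> MC" "wt (exchange u) = wt u"
  using lower_in_MC[OF assms] MC_add_a0 by (auto simp: exchange_def wt_add wt_a0)

text \<open>Take \<open>monom_relation\<close> at v = u - a_j and divide by l_j: x^u and \<lambda>
  x^v x^{a_0} then differ by a multiple of x^v, which is reducible by assumption.\<close>

lemma exchange_reducible:
  assumes u: "u \<in> MC" "u \<notin> BC" and low: "monom (u - a (big_coord u)) \<in> reducible"
  shows "(\<lambda>w. monom u w + - lam * monom (exchange u) w) \<in> reducible"
proof -
  define j where "j = big_coord u"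
  define v where "v = u - a j"
  have j: "j \<in> {1..m}" using big_coord[OF u] by (simp add: j_def)
  have v: "v \<in> MC" using lower_in_MC[OF u] by (simp add: v_def j_def)
  have lj: "(of_int (l j) :: ratfun) \<noteq> 0" using l_pos[OF j] by (simp add: ratfun_of_int_eq_0_iff del: l_pos)
  have red: "monom v \<in> reducible" using low by (simp add: v_def j_def)
  let ?c = "constR (of_real (co j v))" and ?i = "inverse (of_int (l j)) :: ratfun"
  let ?d = "\<lambda>u. ?c * monom v u + of_int (l j) * monom (v + a j) u + - (of_int (l j) * lam) * monom (v + a0) u"
  have "(\<lambda>w. ?i * ?d w + (- (?i * ?c)) * monom v w) \<in> reducible"
    using reducible_add[OF reducible_scale[OF DiImage_reducible[OF monom_relation[OF v j]], of ?i]
      reducible_scale[OF red, of "- (?i * ?c)"]] .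
  moreover have "?i * ?d w + (- (?i * ?c)) * monom v w = monom u w + - lam * monom (exchange u) w" for w
    using lj by (simp add: v_def exchange_def j_def[symmetric] field_simps)
  ultimately show ?thesis by simp
qed

text \<open>Exchanging \<open>a\<^sub>j\<close> for \<open>a\<^sub>0\<close> preserves the weight and costs a factor \<open>\<lambda>\<close> modulo lower weight. Only
  finitely many monomials have a given weight, so an exchange process that never reaches \<open>BC\<close>
  runs into a cycle, on which \<open>x\<^sup>u \<equiv> \<lambda>\<^sup>k x\<^sup>u\<close> with \<open>k > 0\<close>.\<close>

lemma monom_reducible_step:
  assumes u: "u \<in> MC" and low: "\<And>v. v \<in> MC \<Longrightarrow> wt v = wt u - 1 \<Longrightarrow> monom v \<in> reducible"
  shows "monom u \<in> reducible"
proof (rule ccontr)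
  assume nred: "monom u \<notin> reducible"
  \<comment> \<open>The counterexamples of the given weight. \<open>S\<close> avoids
    \<open>BC\<close> and is closed under \<open>exchange\<close>, so the process never stops inside
    it.\<close>
  define S where "S = {x \<in> MC. wt x = wt u \<and> monom x \<notin> reducible}"
  have S_BC: "x \<notin> BC" if "x \<in> S" for x using that BC_reducible by (auto simp: S_def)
  have S_red: "(\<lambda>w. monom x w + - lam * monom (exchange x) w) \<in> reducible" if "x \<in> S" for x
    using that S_BC[OF that] lower_in_MC[of x] low by (intro exchange_reducible) (auto simp: S_def)
  have S_exchange: "exchange x \<in> S" if x: "x \<in> S" for x
  proof -
    have "monom x \<in> reducible" if "monom (exchange x) \<in> reducible"
      using reducible_add[OF S_red[OF x] reducible_scale[OF that, of lam]] by simp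
    thus ?thesis using x exchange_in_MC[of x] S_BC[OF x] by (auto simp: S_def)
  qed
  have S_pow: "(exchange ^^ k) x \<in> S" if "x \<in> S" for k x
    by (induction k) (auto simp: that S_exchange)
  have S_cycle: "(\<lambda>w. monom x w + - (lam ^ k) * monom ((exchange ^^ k) x) w) \<in> reducible" if x: "x \<in> S" for k x
  proof (induction k)
    case 0
    thus ?case using reducible_lin_closed by (simp add: lin_closed_def)
  next
    case (Suc k)
    show ?case
      using reducible_add[OF Suc reducible_scale[OF S_red[OF S_pow[OF x, of k]], of "lam ^ k"]]
      by (simp add: algebra_simps)
  qed
  have "S \<subseteq> {x \<in> Mset a m. wt x \<le> wt u}" by (auto simp: S_def MC_def)
  hence "finite S" using finite_Mset_wt finite_subset by blast
  have uS: "u \<in> S" using u nred by (simp add: S_def)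
  have "finite (range (\<lambda>k. (exchange ^^ k) u))"
    by (rule finite_subset[OF _ \<open>finite S\<close>]) (use S_pow[OF uS] in auto)
  hence "\<not> inj (\<lambda>k. (exchange ^^ k) u)" using finite_imageD infinite_UNIV_nat by blast
  then obtain i k where "(exchange ^^ i) u = (exchange ^^ k) u" "i < k"
    unfolding inj_def by (metis linorder_neqE_nat)
  moreover from this have "(exchange ^^ k) u = (exchange ^^ (k - i)) ((exchange ^^ i) u)"
    by (metis add.commute comp_apply funpow_add le_add_diff_inverse less_imp_le)
  ultimately have cyc: "(exchange ^^ (k - i)) ((exchange ^^ i) u) = (exchange ^^ i) u" by simp
  \<comment> \<open>The orbit of \<open>u\<close> need not return to \<open>u\<close>; the
    contradiction is drawn at the point where the cycle is entered, which also lies in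
    \<open>S\<close>.\<close>
  define x where "x = (exchange ^^ i) u"
  have x: "x \<in> S" unfolding x_def by (rule S_pow[OF uS])
  have "(\<lambda>w. monom x w + - (lam ^ (k - i)) * monom x w) \<in> reducible"
    using S_cycle[OF x, of "k - i"] cyc by (simp add: x_def)
  from reducible_scale[OF this, of "inverse (1 - lam ^ (k - i))"]
  have "(\<lambda>w. inverse (1 - lam ^ (k - i)) * ((1 - lam ^ (k - i)) * monom x w)) \<in> reducible"
    by (simp add: algebra_simps)
  hence "monom x \<in> reducible"
    using lam_power_neq_1[of "k - i"] \<open>i < k\<close> by (simp add: mult.assoc[symmetric])
  thus False using x by (simp add: S_def)
qed

lemma monom_reducible: "u \<in> MC \<Longrightarrow> monom u \<in> reducible"
proof (induction "nat \<lfloor>wt u\<rfloor>" arbitrary: u rule: less_induct)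
  case less
  show ?case
  proof (rule monom_reducible_step[OF less.prems])
    fix v assume v: "v \<in> MC" "wt v = wt u - 1"
    \<comment> \<open>Weights need not be integers, hence the induction on the floor. Nonnegativity
      of \<open>wt v\<close> ensures that \<open>nat\<close> does not flatten the decrease.\<close>
    have "0 \<le> wt v" unfolding wt_def using v by (intro sum_nonneg) (auto simp: MC_def Mset_iff)
    hence "nat \<lfloor>wt v\<rfloor> < nat \<lfloor>wt u\<rfloor>" using v by linarith
    thus "monom v \<in> reducible" using less.hyps v by blast
  qed
qed

lemma Sk_reducible:
  assumes "h \<in> Sk MC" shows "h \<in> reducible"
proof -
  let ?S = "{u. h u \<noteq> 0}"
  have S: "finite ?S" "?S \<subseteq> MC" using assms by (auto simp: Sk_def)
  have "(\<lambda>w. \<Sum>u\<in>?S. h u * monom u w) \<in> reducible"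
    using S by (intro lin_closed_sum[OF reducible_lin_closed] reducible_scale monom_reducible) auto
  moreover have "(\<Sum>u\<in>?S. h u * monom u w) = h w" for w
  proof -
    have "(\<Sum>u\<in>?S. h u * monom u w) = (\<Sum>u\<in>?S. if w = u then h w else 0)"
      by (intro sum.cong) (auto simp: monom_def)
    also have "\<dots> = h w" using S(1) by auto
    finally show ?thesis .
  qed
  ultimately show ?thesis by simp
qed

text \<open>Membership is obtained without exhibiting preimages under the D_i: the remainder of
  \<open>h\<close> on \<open>BC\<close> solves a homogeneous system whose matrix is the identity at
  \<lambda> = 0, so it is zero.\<close>

lemma DiImage_criterion:
  assumes h: "h \<in> Sk MC" and phi0: "\<And>b'. b' \<in> BC \<Longrightarrow> phi b' h = 0"
  shows "h \<in> DiImage a a0 m l MC"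
proof -
  obtain c d where d: "d \<in> DiImage a a0 m l MC" and hcd: "h = (\<lambda>u. (\<Sum>b\<in>BC. c b * monom b u) + d u)"
    using Sk_reducible[OF h] unfolding reducible_def by blast
  have eval: "(\<Sum>b\<in>BC. c b * monom b u) = (if u \<in> BC then c u else 0)" for u
  proof -
    have "(\<Sum>b\<in>BC. c b * monom b u) = (\<Sum>b\<in>BC. if u = b then c u else 0)"
      by (intro sum.cong) (auto simp: monom_def)
    thus ?thesis using finite_BC by simp
  qed
  have fin1: "finite {u. (\<Sum>b\<in>BC. c b * monom b u) \<noteq> 0}"
    unfolding eval by (rule finite_subset[OF _ finite_BC]) auto
  have "rat_to_fls (c b) = 0" if "b \<in> BC" for b
  proof (rule fls_family_zero[OF finite_BC _ _ that, of "\<lambda>b. rat_to_fls (c b)" "\<lambda>b' b. Gser a a0 m l b' b"])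
    fix b' assume b': "b' \<in> BC"
    hence b'B: "b' \<in> Bset a m" by (simp add: BC_def)
    have fin2: "finite {u. d u \<noteq> 0}" using phi_DiImage(1)[OF b'B d] by (simp add: Sk_def)
    have "0 = phi b' (\<lambda>u. \<Sum>b\<in>BC. c b * monom b u) + phi b' d"
      using phi0[OF b'] unfolding hcd phi_add[OF fin1 fin2] by simp
    also have "phi b' d = 0" by (rule phi_DiImage(2)[OF b'B d])
    also have "phi b' (\<lambda>u. \<Sum>b\<in>BC. c b * monom b u)
        = (\<Sum>b\<in>BC. rat_to_fls (c b) * fps_to_fls (Gser a a0 m l b' b))"
      by (subst phi_superset[OF finite_BC]) (auto simp: eval intro!: sum.cong split: if_splits)
    finally show "(\<Sum>b\<in>BC. rat_to_fls (c b) * fps_to_fls (Gser a a0 m l b' b)) = 0" by simp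
  next
    fix b' b assume "b' \<in> BC" "b \<in> BC"
    thus "fps_nth (Gser a a0 m l b' b) 0 = (if b' = b then 1 else 0)"
      by (simp add: Gser_nth gcoef_Bset BC_def)
  qed
  hence "h = d" unfolding hcd by (auto simp: eval)
  thus ?thesis using d by simp
qed

end

section \<open>The reduced hypergeometric operator\<close>

lemma degree_prod_monic_linear: "degree (\<Prod>x\<in>A. [:c x :: 'a :: field, 1:]) = card A"
  by (subst degree_prod_eq_sum_degree) auto

lemma coeff_prod_monic_linear: "coeff (\<Prod>x\<in>A. [:c x :: 'a :: field, 1:]) (card A) = 1"
  using lead_coeff_prod[of "\<lambda>x. [:c x, 1:]" A] degree_prod_monic_linear[of c A] by simp

text \<open>This turns \<open>p(\<lambda>\<partial>)\<close> into \<open>\<Sum>\<^sub>i e\<^sub>i \<lambda>\<^sup>i \<partial>\<^sup>i\<close>.\<close>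

lemma falling_factorial_expansion:
  fixes p :: "'a :: field poly"
  assumes "degree p \<le> r"
  shows "\<exists>e. (\<forall>x. poly p x = (\<Sum>i\<le>r. e i * (\<Prod>k<i. x - of_nat k))) \<and> e r = coeff p r"
  using assms
proof (induction r arbitrary: p)
  case 0
  then obtain c where "p = [:c:]" by (metis degree_eq_zeroE le_zero_eq)
  thus ?case by (intro exI[of _ "\<lambda>_. c"]) simp
next
  case (Suc r)
  define q where "q = (\<Prod>k<Suc r. [:- of_nat k :: 'a, 1:])"
  have dq: "degree q = Suc r" and lq: "coeff q (Suc r) = 1"
    using degree_prod_monic_linear[of "\<lambda>k. - of_nat k :: 'a" "{..<Suc r}"]
      coeff_prod_monic_linear[of "\<lambda>k. - of_nat k :: 'a" "{..<Suc r}"]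
    by (simp_all only: q_def card_lessThan)
  \<comment> \<open>The top coefficient is split off with the monic falling factorial
    \<open>q\<close> of degree \<open>Suc r\<close>.\<close>
  define p' where "p' = p - smult (coeff p (Suc r)) q"
  have "degree p' \<le> Suc r"
    unfolding p'_def using Suc.prems dq by (intro degree_diff_le) (auto intro: order_trans[OF degree_smult_le])
  moreover have "coeff p' (Suc r) = 0" by (simp add: p'_def lq)
  ultimately have "degree p' \<le> r"
    by (metis degree_0 eq_zero_or_degree_less le_SucE le_Suc_eq less_Suc_eq_le zero_le)
  from Suc.IH[OF this] obtain e where e: "\<And>x. poly p' x = (\<Sum>i\<le>r. e i * (\<Prod>k<i. x - of_nat k))" by blast
  define e' where "e' = e(Suc r := coeff p (Suc r))"
  have "poly p x = (\<Sum>i\<le>Suc r. e' i * (\<Prod>k<i. x - of_nat k))" for x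
  proof -
    have "poly p x = poly p' x + coeff p (Suc r) * poly q x" by (simp add: p'_def)
    also have "poly p' x = (\<Sum>i\<le>r. e' i * (\<Prod>k<i. x - of_nat k))"
      unfolding e by (intro sum.cong) (auto simp: e'_def)
    also have "poly q x = (\<Prod>k<Suc r. x - of_nat k)" unfolding q_def poly_prod by simp
    finally show ?thesis by (simp add: e'_def)
  qed
  thus ?case by (intro exI[of _ e']) (simp add: e'_def)
qed

text \<open>The eigenvalue of \<lambda>^i \<partial>^i on \<lambda>^n is a falling factorial; the
  induction rests on \<lambda>^{i+1} \<partial>^{i+1} = (\<lambda>\<partial> - i) \<lambda>^i
  \<partial>^i.\<close>

lemma fps_X_power_deriv_nth:
  fixes G :: "complex fps"
  shows "fps_nth (fps_X ^ i * (fps_deriv ^^ i) G) n = (\<Prod>k<i. of_nat n - of_nat k) * fps_nth G n"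
proof (induction i)
  case (Suc i)
  define H where "H = (fps_deriv ^^ i) G"
  have "fps_X * fps_deriv (fps_X ^ i) = of_nat i * (fps_X ^ i :: complex fps)"
    by (induction i) (simp_all add: algebra_simps del: fps_deriv_power)
  hence "fps_X * fps_deriv (fps_X ^ i) * H = of_nat i * fps_X ^ i * H" by (rule arg_cong)
  hence "fps_X * fps_deriv (fps_X ^ i * H) = fps_X ^ Suc i * fps_deriv H + of_nat i * (fps_X ^ i * H)"
    by (simp add: algebra_simps del: fps_deriv_power)
  hence "fps_X ^ Suc i * fps_deriv H = fps_X * fps_deriv (fps_X ^ i * H) - of_nat i * (fps_X ^ i * H)"
    by simp
  moreover have "fps_nth (fps_X * fps_deriv F) n = of_nat n * fps_nth F n" for F :: "complex fps"
    by (cases n) auto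
  moreover have "fps_nth (of_nat i * F) n = of_nat i * fps_nth F n" for F :: "complex fps"
    by (simp add: fps_of_nat[symmetric] del: fps_of_nat)
  ultimately have "fps_nth (fps_X ^ Suc i * fps_deriv H) n
      = of_nat n * fps_nth (fps_X ^ i * H) n - of_nat i * fps_nth (fps_X ^ i * H) n"
    by (simp only: fps_sub_nth)
  also have "\<dots> = (of_nat n - of_nat i) * fps_nth (fps_X ^ i * H) n" by (simp add: algebra_simps)
  finally show ?case using Suc by (simp add: H_def mult.assoc mult.commute)
qed simp

text \<open>The recurrence says p(\<theta>) G = \<lambda>^N q(\<theta>) G for \<theta> =
  \<lambda>\<partial>. Expanding p and q in falling factorials, with coefficients e_i and f_i, gives
  the coefficient \<lambda>^i (e_i - f_i \<lambda>^N) of \<partial>^i.\<close>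

lemma hypergeometric_operator:
  fixes p q :: "complex poly"
  assumes "degree p \<le> r" "degree q \<le> r"
  shows "\<exists>c :: nat \<Rightarrow> ratfun. c r = lam ^ r * (constR (coeff p r) - constR (coeff q r) * lam ^ N) \<and>
    (\<forall>G. (\<forall>n. poly p (of_nat n) * fps_nth G n
            = (if n < N then 0 else poly q (of_nat (n - N)) * fps_nth G (n - N))) \<longrightarrow>
      (\<Sum>i\<le>r. rat_to_fls (c i) * fps_to_fls ((fps_deriv ^^ i) G)) = 0)"
proof -
  obtain e where e: "\<And>x. poly p x = (\<Sum>i\<le>r. e i * (\<Prod>k<i. x - of_nat k))" "e r = coeff p r"
    using falling_factorial_expansion[OF assms(1)] by blast
  obtain f where f: "\<And>x. poly q x = (\<Sum>i\<le>r. f i * (\<Prod>k<i. x - of_nat k))" "f r = coeff q r"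
    using falling_factorial_expansion[OF assms(2)] by blast
  define c where "c = (\<lambda>i. lam ^ i * (constR (e i) - constR (f i) * lam ^ N))"
  have "(\<Sum>i\<le>r. rat_to_fls (c i) * fps_to_fls ((fps_deriv ^^ i) G)) = 0"
    if G: "\<And>n. poly p (of_nat n) * fps_nth G n
            = (if n < N then 0 else poly q (of_nat (n - N)) * fps_nth G (n - N))" for G
  proof -
    define T where "T = (\<lambda>i. fps_X ^ i * (fps_deriv ^^ i) G)"
    have term_eq: "rat_to_fls (c i) * fps_to_fls ((fps_deriv ^^ i) G)
        = fps_to_fls (fps_const (e i) * T i - fps_X ^ N * (fps_const (f i) * T i))" for i
      by (simp add: c_def T_def rat_to_fls_mult rat_to_fls_diff rat_to_fls_power rat_to_fls_lam
          rat_to_fls_constR fls_times_fps_to_fls fps_to_fls_power fps_X_to_fls algebra_simps)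
    have sum: "fps_to_fls (sum F A) = (\<Sum>i\<in>A. fps_to_fls (F i))" for F :: "nat \<Rightarrow> complex fps" and A
      by (induction A rule: infinite_finite_induct) auto
    have zero: "(\<Sum>i\<le>r. fps_const (e i) * T i - fps_X ^ N * (fps_const (f i) * T i)) = 0"
    proof (rule fps_ext)
      fix n
      have E: "fps_nth (\<Sum>i\<le>r. fps_const (e i) * T i) n = poly p (of_nat n) * fps_nth G n" for n
        by (simp add: fps_sum_nth T_def fps_X_power_deriv_nth e(1) sum_distrib_right mult.assoc)
      have F: "fps_nth (\<Sum>i\<le>r. fps_const (f i) * T i) n = poly q (of_nat n) * fps_nth G n" for n
        by (simp add: fps_sum_nth T_def fps_X_power_deriv_nth f(1) sum_distrib_right mult.assoc)
      have "fps_nth (\<Sum>i\<le>r. fps_const (e i) * T i - fps_X ^ N * (fps_const (f i) * T i)) n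
        = fps_nth (\<Sum>i\<le>r. fps_const (e i) * T i) n - fps_nth (fps_X ^ N * (\<Sum>i\<le>r. fps_const (f i) * T i)) n"
        by (simp only: sum_subtractf sum_distrib_left fps_sub_nth)
      thus "fps_nth (\<Sum>i\<le>r. fps_const (e i) * T i - fps_X ^ N * (fps_const (f i) * T i)) n = fps_nth 0 n"
        unfolding E fps_X_power_mult_nth F using G[of n] by auto
    qed
    show ?thesis unfolding term_eq sum[symmetric] zero by simp
  qed
  thus ?thesis using e(2) f(2) by (intro exI[of _ c]) (auto simp: c_def)
qed

text \<open>In this descending form the factors are t + n - s for s < n, so for n = \<open>N\<close>
  they are the values of \<lambda>\<partial> - s on \<lambda>^{t+N}, one per residue.\<close>

lemma fact_add_prod:
  "(of_nat (fact (t + n)) :: complex) = of_nat (fact t) * (\<Prod>i<n. of_nat (t + n) - of_nat i)"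
proof -
  have "(of_nat (fact (t + n)) :: complex) = of_nat (fact t) * (\<Prod>i<n. of_nat (t + Suc i))"
    by (induction n) (simp_all add: algebra_simps)
  also have "(\<Prod>i<n. of_nat (t + Suc i) :: complex) = (\<Prod>i<n. of_nat (t + Suc (n - Suc i)))"
    by (rule prod.nat_diff_reindex[symmetric])
  also have "\<dots> = (\<Prod>i<n. of_nat (t + n) - of_nat i)"
    by (intro prod.cong) (auto simp: of_nat_diff)
  finally show ?thesis .
qed

section \<open>The series at a fixed b, sorted by residues modulo l_0\<close>

locale lattice_coset_point = lattice_coset a a0 m l C
  for a :: "nat \<Rightarrow> int ^ 'n" and a0 m l C +
  fixes b :: "int ^ 'n"
  assumes b_in_BC: "b \<in> BC"
begin

abbreviation G :: "int ^ 'n \<Rightarrow> complex fps" where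
  "G b' \<equiv> Gser a a0 m l b' b"

definition N :: nat where "N = nat (l 0)"

lemma N_pos: "0 < N" and int_N: "int N = l 0"
  using l0_pos by (simp_all add: N_def del: l0_pos)

lemma l0_N: "l 0 = int N"
  by (simp add: int_N)

definition pt :: "nat \<Rightarrow> int ^ 'n" where "pt t = b + int t *s a0"

text \<open>The part of the condition for a nonzero coefficient of \<lambda>^t that does not depend
  on b'.\<close>

definition ok :: "nat \<Rightarrow> bool" where
  "ok t \<longleftrightarrow> (\<forall>j\<in>{1..m}. \<not> (co j (pt t) \<in> \<int> \<and> 1 \<le> co j (pt t)))"

text \<open>Reduction of \<open>pt s\<close> into the half-open parallelepiped by taking fractional
  parts: the only b' whose series can contain \<lambda>^s.\<close>

definition residue_pt :: "nat \<Rightarrow> int ^ 'n" where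
  "residue_pt s = pt s - (\<Sum>j\<in>{1..m}. \<lfloor>co j (pt s)\<rfloor> *s a j)"

lemma b_props: "b \<in> Bset a m" "b \<in> Mset a m" "b \<in> C" "b \<in> MC"
  using b_in_BC BC_subset_MC by (auto simp: BC_def MC_def)

lemma co_b: "j \<in> {1..m} \<Longrightarrow> 0 \<le> co j b" "j \<in> {1..m} \<Longrightarrow> co j b < 1"
  using b_props by (auto simp: Bset_iff)

lemma co_pt: "j \<in> {1..m} \<Longrightarrow> co j (pt t) = co j b + real t * of_int (l j) / real N"
  by (simp add: pt_def co_add co_smult co_a0 l0_N)

lemma pt_Mset: "pt t \<in> Mset a m"
  unfolding pt_def by (rule Mset_add_a0_smult[OF b_props(2)])

lemma pt_C: "pt t \<in> C"
  unfolding pt_def by (rule coset_add_a0_smult[OF coset b_props(3)])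

lemma co_pt_add_N:
  assumes "j \<in> {1..m}" shows "co j (pt (t + k * N)) = co j (pt t) + of_int (int k * l j)"
  using N_pos by (simp add: co_pt[OF assms] field_simps)

text \<open>The j-th coordinates differ by (s - t) l_j / l_0, so integrality means that l_0 divides
  every (s - t) l_j. Since the gcd of all l_j is 1, l_0 divides s - t.\<close>

lemma co_pt_cong_iff:
  "(\<forall>j\<in>{1..m}. co j (pt s) - co j (pt t) \<in> \<int>) \<longleftrightarrow> s mod N = t mod N"
proof
  assume *: "\<forall>j\<in>{1..m}. co j (pt s) - co j (pt t) \<in> \<int>"
  define d where "d = int s - int t"
  have "l 0 dvd d * l j" if j: "j \<in> {0..m}" for j
  proof (cases "j = 0")
    case False
    hence j: "j \<in> {1..m}" using j by auto
    obtain z where "co j (pt s) - co j (pt t) = of_int z" using bspec[OF * j] by (rule Ints_cases)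
    hence "(real s - real t) * of_int (l j) / real N = of_int z"
      by (simp add: co_pt[OF j] left_diff_distrib diff_divide_distrib)
    hence "(real s - real t) * of_int (l j) = of_int z * real N" using N_pos by (simp add: divide_eq_eq)
    hence "real_of_int (d * l j) = of_int (z * l 0)" by (simp add: d_def l0_N)
    hence "d * l j = z * l 0" by (simp only: of_int_eq_iff)
    thus ?thesis by simp
  qed simp
  hence "l 0 dvd Gcd ((*) d ` (l ` {0..m}))" by (intro Gcd_greatest) auto
  hence "l 0 dvd d" using lgcd by (simp add: Gcd_mult)
  thus "s mod N = t mod N"
    unfolding d_def l0_N by (metis mod_eq_dvd_iff of_nat_eq_iff zmod_int)
next
  assume eq: "s mod N = t mod N"
  have "co j (pt s) - co j (pt t) \<in> \<int>" if "j \<in> {1..m}" for j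
  proof -
    have "co j (pt x) = co j (pt (x mod N)) + of_int (int (x div N) * l j)" for x
      using co_pt_add_N[OF that, of "x mod N" "x div N"] by simp
    from this[of s] this[of t] eq have "co j (pt s) - co j (pt t)
       = of_int (int (s div N) * l j - int (t div N) * l j)" by simp
    thus ?thesis by (metis Ints_of_int)
  qed
  thus "\<forall>j\<in>{1..m}. co j (pt s) - co j (pt t) \<in> \<int>" by blast
qed

text \<open>Passing from t mod N to t adds nonnegative integers to the coordinates, so a positive
  integral coordinate persists. The converse can fail: a coordinate 0 becomes a positive integer,
  and the series then breaks off.\<close>

lemma ok_mod:
  assumes "ok t" shows "ok (t mod N)"
proof -
  have "\<not> (co j (pt (t mod N)) \<in> \<int> \<and> 1 \<le> co j (pt (t mod N)))" if j: "j \<in> {1..m}" for j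
  proof
    assume A: "co j (pt (t mod N)) \<in> \<int> \<and> 1 \<le> co j (pt (t mod N))"
    have e: "co j (pt t) = co j (pt (t mod N)) + of_int (int (t div N) * l j)"
      using co_pt_add_N[OF j, of "t mod N" "t div N"] by simp
    have "(0::real) \<le> of_int (int (t div N) * l j)" using l_pos[OF j] by simp
    hence "1 \<le> co j (pt t)" using A e by linarith
    moreover have "co j (pt t) \<in> \<int>" unfolding e using A by (intro Ints_add) auto
    ultimately show False using assms j by (auto simp: ok_def)
  qed
  thus ?thesis by (simp add: ok_def)
qed

lemma co_residue_pt: "j \<in> {1..m} \<Longrightarrow> co j (residue_pt s) = frac (co j (pt s))"
  by (simp add: residue_pt_def co_diff co_lincomb frac_def del: One_nat_def)

lemma residue_pt_BC: "residue_pt s \<in> BC"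
proof -
  have "residue_pt s \<in> VZ a m" unfolding residue_pt_def
    using pt_Mset by (intro VZ_diff VZ_sum VZ_smult a_in_VZ) (auto simp: Mset_iff)
  hence "residue_pt s \<in> Bset a m"
    by (auto simp: Bset_iff co_residue_pt frac_lt_1)
  moreover have "residue_pt s \<in> C"
    using coset_add[OF coset pt_C[of s], of 0 "\<lambda>j. - \<lfloor>co j (pt s)\<rfloor>"]
    by (simp add: residue_pt_def vector_smult_lneg sum_negf)
  ultimately show ?thesis by (simp add: BC_def)
qed

lemma co_pt_residue:
  assumes "j \<in> {1..m}"
  shows "co j (pt t) - co j (residue_pt s) \<in> \<int> \<longleftrightarrow> co j (pt t) - co j (pt s) \<in> \<int>"
proof -
  have "co j (pt t) - co j (residue_pt s) = (co j (pt t) - co j (pt s)) + of_int \<lfloor>co j (pt s)\<rfloor>"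
    by (simp add: co_residue_pt[OF assms] frac_def)
  thus ?thesis by (metis Ints_add Ints_diff Ints_of_int add_diff_cancel_right')
qed

text \<open>Injectivity is the congruence criterion. For surjectivity, an element of the coset is b
  + z_0 a_0 plus an integral combination of the a_j, and only z_0 mod l_0 matters, because l_0 a_0
  is itself such a combination.\<close>

lemma residue_pt_bij: "bij_betw residue_pt {..<N} BC"
proof (rule bij_betwI')
  fix s t assume st: "s \<in> {..<N}" "t \<in> {..<N}"
  show "(residue_pt s = residue_pt t) = (s = t)"
  proof
    assume e: "residue_pt s = residue_pt t"
    have "\<forall>j\<in>{1..m}. co j (pt s) - co j (pt t) \<in> \<int>"
    proof
      fix j assume j: "j \<in> {1..m}"
      have "co j (pt s) - co j (residue_pt s) \<in> \<int>" using co_pt_residue[OF j, of s s] by simp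
      thus "co j (pt s) - co j (pt t) \<in> \<int>" unfolding e by (simp only: co_pt_residue[OF j])
    qed
    thus "s = t" using st by (simp only: co_pt_cong_iff) simp
  qed simp
next
  fix b' assume b': "b' \<in> BC"
  obtain z0 z where z: "b' = b + z0 *s a0 + (\<Sum>j\<in>{1..m}. z j *s a j)"
    using coset_rel[OF coset b_props(3), of b'] b' by (auto simp: BC_def)
  define s where "s = nat (z0 mod l 0)"
  have s: "int s = z0 - z0 div l 0 * l 0" using l0_pos by (simp add: s_def minus_div_mult_eq_mod del: l0_pos)
  have "residue_pt s = b'"
  proof (rule VZ_eqI)
    fix j assume j: "j \<in> {1..m}"
    have "co j b' = co j b + of_int z0 * co j a0 + of_int (z j)"
      unfolding z by (simp only: co_add[OF j] co_smult[OF j] co_lincomb[OF j])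
    moreover have "co j (pt s) = co j b + (of_int z0 - of_int (z0 div l 0) * of_int (l 0)) * co j a0"
    proof -
      have "real_of_int (int s) = of_int z0 - of_int (z0 div l 0) * of_int (l 0)"
        unfolding s by simp
      thus ?thesis by (simp add: pt_def co_add[OF j] co_smult[OF j])
    qed
    moreover have "of_int (l 0) * co j a0 = of_int (l j)" using l0_pos by (simp add: co_a0[OF j] del: l0_pos)
    ultimately have "co j (pt s) - co j b' = of_int (- (z0 div l 0) * l j - z j)"
      by (simp add: left_diff_distrib mult.assoc)
    hence "co j (pt s) - co j b' \<in> \<int>" by (metis Ints_of_int)
    moreover have "co j (residue_pt s) - co j b' = (co j (pt s) - co j b') - of_int \<lfloor>co j (pt s)\<rfloor>"
      by (simp add: co_residue_pt[OF j] frac_def)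
    ultimately have "co j (residue_pt s) - co j b' \<in> \<int>" by (metis Ints_diff Ints_of_int)
    thus "co j (residue_pt s) = co j b'"
      using b' residue_pt_BC[of s] j by (intro frac_eq_less_1) (auto simp: BC_def Bset_iff)
  qed (use b' residue_pt_BC[of s] in \<open>auto simp: BC_def Bset_iff\<close>)
  moreover have "s < N" unfolding s_def N_def using l0_pos by (simp add: nat_less_eq_zless del: l0_pos)
  ultimately show "\<exists>s\<in>{..<N}. b' = residue_pt s" by blast
qed (simp add: residue_pt_BC)

lemma G_nth: "fps_nth (G b') t = gcoef a m l b' (pt t) * (- of_int (l 0)) ^ t / of_nat (fact t)"
  by (simp add: Gser_nth pt_def)

lemma G_nth_nonzero_iff:
  assumes "b' \<in> BC"
  shows "fps_nth (G b') t \<noteq> 0 \<longleftrightarrow> (\<forall>j\<in>{1..m}. co j (pt t) - co j b' \<in> \<int>) \<and> ok t"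
proof -
  have "fps_nth (G b') t \<noteq> 0 \<longleftrightarrow> gcoef a m l b' (pt t) \<noteq> 0"
    using l0_pos by (simp add: G_nth del: l0_pos)
  thus ?thesis using gcoef_nonzero_iff[of b' "pt t"] assms pt_Mset by (simp add: BC_def ok_def)
qed

definition good :: "nat set" where "good = {s. s < N \<and> ok s}"

lemma finite_good: "finite good"
  by (simp add: good_def)

text \<open>The series of class s lives on exponents t with t mod N = s. By \<open>ok_mod\<close>
  any nonzero coefficient forces the one at s itself to be nonzero.\<close>

lemma G_nonzero_eq: "{b' \<in> BC. G b' \<noteq> 0} = residue_pt ` good"
proof -
  have key: "G (residue_pt s) = 0 \<longleftrightarrow> \<not> ok s" if s: "s < N" for s
  proof -
    have nz: "fps_nth (G (residue_pt s)) t \<noteq> 0 \<longleftrightarrow> t mod N = s \<and> ok t" for t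
      using co_pt_cong_iff[of t s] s
      by (simp add: G_nth_nonzero_iff[OF residue_pt_BC] co_pt_residue del: One_nat_def)
    have "G (residue_pt s) \<noteq> 0 \<longleftrightarrow> ok s"
    proof
      assume "G (residue_pt s) \<noteq> 0"
      then obtain t where "fps_nth (G (residue_pt s)) t \<noteq> 0" by (auto simp: fps_eq_iff)
      thus "ok s" using nz ok_mod by auto
    next
      assume "ok s"
      hence "fps_nth (G (residue_pt s)) s \<noteq> 0" using nz s by simp
      thus "G (residue_pt s) \<noteq> 0" by auto
    qed
    thus ?thesis by blast
  qed
  have "BC = residue_pt ` {..<N}" using residue_pt_bij by (simp add: bij_betw_def)
  thus ?thesis by (auto simp: good_def key)
qed

lemma card_G_nonzero: "card {b' \<in> BC. G b' \<noteq> 0} = card good"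
  unfolding G_nonzero_eq
  using residue_pt_bij by (intro card_image) (auto simp: bij_betw_def good_def intro: inj_on_subset)

text \<open>Distinct \<open>b'\<close> contribute to distinct powers of \<open>\<lambda>\<close>.\<close>

lemma G_independent:
  assumes "(\<Sum>b' | b' \<in> BC \<and> G b' \<noteq> 0. fps_const (w b') * G b') = 0" "b' \<in> BC" "G b' \<noteq> 0"
  shows "w b' = (0 :: complex)"
proof -
  let ?A = "{b' \<in> BC. G b' \<noteq> 0}"
  obtain t where t: "fps_nth (G b') t \<noteq> 0" using assms(3) by (auto simp: fps_eq_iff)
  \<comment> \<open>At an exponent t that occurs in \<open>G b'\<close> no other series contributes:
    both indices would be congruent to \<open>pt t\<close>, hence equal.\<close>
  have other: "fps_nth (G b'') t = 0" if "b'' \<in> BC" "b'' \<noteq> b'" for b''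
  proof (rule ccontr)
    assume "fps_nth (G b'') t \<noteq> 0"
    hence i: "\<forall>j\<in>{1..m}. co j (pt t) - co j b' \<in> \<int>" "\<forall>j\<in>{1..m}. co j (pt t) - co j b'' \<in> \<int>"
      using t G_nth_nonzero_iff assms(2) that(1) by blast+
    have "b'' = b'"
    proof (rule VZ_eqI)
      fix j assume j: "j \<in> {1..m}"
      have "(co j (pt t) - co j b') - (co j (pt t) - co j b'') \<in> \<int>"
        using Ints_diff[OF bspec[OF i(1) j] bspec[OF i(2) j]] .
      hence "co j b'' - co j b' \<in> \<int>" by simp
      thus "co j b'' = co j b'" using that(1) assms(2) j
        by (intro frac_eq_less_1) (auto simp: BC_def Bset_iff)
    qed (use that(1) assms(2) in \<open>auto simp: BC_def Bset_iff\<close>)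
    thus False using that by simp
  qed
  have "0 = fps_nth (\<Sum>b'\<in>?A. fps_const (w b') * G b') t" using assms(1) by simp
  also have "\<dots> = (\<Sum>b''\<in>?A. if b'' = b' then w b' * fps_nth (G b') t else 0)"
    unfolding fps_sum_nth by (intro sum.cong) (auto simp: other)
  also have "\<dots> = w b' * fps_nth (G b') t" using assms finite_BC by simp
  finally show ?thesis using t by simp
qed

text \<open>The upper parameters of the recurrence, scaled so that l_0 (co_j(b + t a_0) + i) / l_j =
  t + \<open>rho (j, i)\<close>.\<close>

definition rho :: "nat \<times> nat \<Rightarrow> real" where
  "rho = (\<lambda>(j, i). real N * (co j b + real i) / of_int (l j))"

definition Ix :: "(nat \<times> nat) set" where
  "Ix = (SIGMA j:{1..m}. {..<nat (l j)})"

lemma finite_Ix: "finite Ix"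
  by (simp add: Ix_def)

lemma sum_nat_l: "(\<Sum>j\<in>{1..m}. nat (l j)) = N"
proof -
  have "int (\<Sum>j\<in>{1..m}. nat (l j)) = (\<Sum>j\<in>{1..m}. l j)"
    unfolding of_nat_sum by (intro sum.cong) (auto intro!: less_imp_le)
  hence "int (\<Sum>j\<in>{1..m}. nat (l j)) = int N" by (simp only: int_N lsum)
  thus ?thesis by (simp only: of_nat_eq_iff)
qed

lemma card_Ix: "card Ix = N"
  unfolding sum_nat_l[symmetric] Ix_def by simp

text \<open>N steps along a_0 amount to l_j steps along each a_j, so the coefficient gains one
  factor per element of \<open>Ix\<close>; the left-hand product is the quotient of the
  factorials.\<close>

lemma G_recurrence:
  assumes b': "b' \<in> BC"
  shows "(\<Prod>s<N. of_nat (t + N) - of_nat s) * fps_nth (G b') (t + N)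
       = (\<Prod>x\<in>Ix. of_nat t + of_real (rho x)) * fps_nth (G b') t"
proof -
  have b'B: "b' \<in> Bset a m" using b' by (simp add: BC_def)
  let ?L = "- complex_of_int (l 0)"
  have "pt (t + N) = pt t + l 0 *s a0"
    by (simp add: pt_def l0_N vector_sadd_rdistrib algebra_simps)
  hence g: "gcoef a m l b' (pt (t + N)) = gcoef a m l b' (pt t) *
      (\<Prod>j\<in>{1..m}. \<Prod>i<nat (l j). - (of_real (co j (pt t)) + of_nat i) / of_int (l j))"
    using gcoef_add_lincomb[OF b'B pt_Mset[of t] subset_refl] by (simp add: rel)
  \<comment> \<open>\<open>Ix\<close> has exactly N elements, so each factor absorbs one copy of -
    l_0; this cancels the sign and turns the factor into t + rho.\<close>
  have "?L ^ N = (\<Prod>j\<in>{1..m}. \<Prod>i<nat (l j). ?L)"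
    by (simp add: prod_constant power_sum[symmetric] sum_nat_l del: One_nat_def)
  hence "(\<Prod>j\<in>{1..m}. \<Prod>i<nat (l j). - (of_real (co j (pt t)) + of_nat i) / of_int (l j)) * ?L ^ N
      = (\<Prod>j\<in>{1..m}. \<Prod>i<nat (l j). - (of_real (co j (pt t)) + of_nat i) / of_int (l j) * ?L)"
    by (simp only: prod.distrib)
  also have "\<dots> = (\<Prod>j\<in>{1..m}. \<Prod>i<nat (l j). of_nat t + of_real (rho (j, i)))"
  proof (intro prod.cong refl)
    fix j i assume j: "j \<in> {1..m}"
    have lj: "real_of_int (l j) \<noteq> 0" using l_pos[OF j] by (simp del: l_pos)
    have "(co j (pt t) + real i) / of_int (l j) * real N = real t + rho (j, i)"
      using lj N_pos by (simp add: co_pt[OF j] rho_def field_simps)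
    hence "complex_of_real ((co j (pt t) + real i) / of_int (l j) * real N) = of_real (real t + rho (j, i))"
      by (rule arg_cong)
    thus "- (of_real (co j (pt t)) + of_nat i) / of_int (l j) * ?L = of_nat t + of_real (rho (j, i))"
      unfolding minus_divide_left[symmetric] minus_mult_minus by (simp add: l0_N)
  qed
  also have "\<dots> = (\<Prod>x\<in>Ix. of_nat t + of_real (rho x))"
    unfolding Ix_def by (simp add: prod.Sigma)
  finally have key: "(\<Prod>j\<in>{1..m}. \<Prod>i<nat (l j). - (of_real (co j (pt t)) + of_nat i) / of_int (l j)) * ?L ^ N
     = (\<Prod>x\<in>Ix. of_nat t + of_real (rho x))" .
  have cancel: "x * (y / (z * x)) = y / z" if "x \<noteq> 0" for x y z :: complex
    using that by simp
  have F: "(\<Prod>s<N. of_nat (t + N) - of_nat s :: complex) \<noteq> 0"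
    using fact_add_prod[of t N] by (metis fact_nonzero mult_zero_right of_nat_eq_0_iff)
  have "(\<Prod>s<N. of_nat (t + N) - of_nat s) * fps_nth (G b') (t + N)
     = gcoef a m l b' (pt (t + N)) * ?L ^ (t + N) / of_nat (fact t)"
    unfolding G_nth fact_add_prod by (rule cancel[OF F])
  also have "\<dots> = ((\<Prod>j\<in>{1..m}. \<Prod>i<nat (l j). - (of_real (co j (pt t)) + of_nat i) / of_int (l j)) * ?L ^ N)
     * (gcoef a m l b' (pt t) * ?L ^ t / of_nat (fact t))"
    unfolding g power_add by (simp only: ac_simps times_divide_eq_right times_divide_eq_left)
  finally show ?thesis unfolding key G_nth .
qed

definition bad :: "nat set" where "bad = {s. s < N \<and> \<not> ok s}"

text \<open>If the j-th coordinate of b + s a_0 is the integer p, then co_j(b) = p - s l_j / N, and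
  i = l_j - p gives rho = N - s.\<close>

lemma bad_rho:
  assumes "s \<in> bad" shows "\<exists>x\<in>Ix. rho x = real N - real s"
proof -
  obtain j where j: "j \<in> {1..m}" "co j (pt s) \<in> \<int>" "1 \<le> co j (pt s)"
    using assms by (auto simp: bad_def ok_def)
  obtain p where p: "co j (pt s) = of_int p" using j(2) by (rule Ints_cases)
  have s: "s < N" using assms by (simp add: bad_def)
  have lj: "0 < real_of_int (l j)" using l_pos[OF j(1)] by simp
  have "real s * of_int (l j) / real N < of_int (l j)" using s lj N_pos by (simp add: field_simps)
  \<comment> \<open>s < N and co_j(b) < 1 bound p from above by l_j, and badness gives p at least 1;
    hence 0 \<le> i < l_j.\<close>
  hence "real_of_int p < 1 + of_int (l j)" using p co_pt[OF j(1), of s] co_b(2)[OF j(1)] by linarith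
  hence p': "1 \<le> p" "p \<le> l j" using j(3) p by linarith+
  define i where "i = nat (l j - p)"
  have i: "real i = of_int (l j) - of_int p" using p' by (simp add: i_def)
  have "(j, i) \<in> Ix" using j p' by (auto simp: Ix_def i_def)
  moreover have "rho (j, i) = real N - real s"
    using p co_pt[OF j(1), of s] lj N_pos by (simp add: rho_def i field_simps)
  ultimately show ?thesis by blast
qed

text \<open>For \<open>s \<in> bad\<close> the factors \<open>\<lambda>\<partial> - s\<close> of the left hand side and \<open>\<lambda>\<partial> + (N - s)\<close> of the right hand
  side of the hypergeometric equation cancel; what is left has order \<open>card good\<close>.\<close>

lemma reduced_recurrence:
  "\<exists>p q. degree p = card good \<and> coeff p (card good) = 1 \<and> degree q = card good \<and> coeff q (card good) = 1 \<and>
     (\<forall>b'\<in>BC. \<forall>n. poly p (of_nat n) * fps_nth (G b') n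
        = (if n < N then 0 else poly q (of_nat (n - N)) * fps_nth (G b') (n - N)))"
proof -
  have "\<forall>s\<in>bad. \<exists>x. x \<in> Ix \<and> rho x = real N - real s" using bad_rho by blast
  from bchoice[OF this] obtain pick where pick: "\<forall>s\<in>bad. pick s \<in> Ix \<and> rho (pick s) = real N - real s" ..
  define I' where "I' = Ix - pick ` bad"
  have part: "{..<N} = good \<union> bad" "good \<inter> bad = {}" "finite bad" by (auto simp: good_def bad_def)
  \<comment> \<open>The value N - s of \<open>rho\<close> at \<open>pick s\<close> determines s, so
    different bad classes use up different factors.\<close>
  have inj: "inj_on pick bad"
  proof (rule inj_onI)
    fix s t assume st: "s \<in> bad" "t \<in> bad" "pick s = pick t"
    show "s = t"
      using conjunct2[OF bspec[OF pick st(1)]] conjunct2[OF bspec[OF pick st(2)]]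
      unfolding st(3) by linarith
  qed
  have sub: "pick ` bad \<subseteq> Ix" using pick by blast
  have cN: "card good + card bad = N"
    using card_Un_disjoint[OF finite_good part(3,2)] unfolding part(1)[symmetric] by simp
  have cI: "card I' = card good"
    unfolding I'_def using card_Diff_subset[OF finite_imageI[OF part(3)] sub] card_image[OF inj] card_Ix cN by simp
  define p where "p = (\<Prod>s\<in>good. [:- of_nat s :: complex, 1:])"
  define q where "q = (\<Prod>x\<in>I'. [:of_real (rho x) :: complex, 1:])"
  have "poly p (of_nat n) * fps_nth (G b') n
        = (if n < N then 0 else poly q (of_nat (n - N)) * fps_nth (G b') (n - N))" if b': "b' \<in> BC" for b' n
  proof (cases "n < N")
    case True
    \<comment> \<open>Below N a nonzero coefficient sits at a good residue, and these are the roots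
      of \<open>p\<close>.\<close>
    have "poly p (of_nat n) = 0" if "fps_nth (G b') n \<noteq> 0"
    proof -
      have "n \<in> good" using True that G_nth_nonzero_iff[OF b'] by (simp add: good_def)
      thus ?thesis unfolding p_def poly_prod using finite_good by (intro prod_zero) auto
    qed
    thus ?thesis using True by auto
  next
    case False
    define t where "t = n - N"
    have n: "n = t + N" using False by (simp add: t_def)
    define B where "B = (\<Prod>s\<in>bad. of_nat (t + N) - of_nat s :: complex)"
    \<comment> \<open>Each factor t + N - s is positive since s < N; this permits the
      cancellation.\<close>
    have "B \<noteq> 0" unfolding B_def by (auto simp: bad_def prod_zero_iff simp flip: of_nat_add)
    have 1: "(\<Prod>s<N. of_nat (t + N) - of_nat s) = poly p (of_nat n) * B"
      unfolding part(1) prod.union_disjoint[OF finite_good part(3,2)]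
      by (simp add: p_def poly_prod B_def n)
    have "(\<Prod>x\<in>pick ` bad. of_nat t + complex_of_real (rho x)) = (\<Prod>s\<in>bad. of_nat t + complex_of_real (rho (pick s)))"
      by (simp add: prod.reindex[OF inj])
    also have "\<dots> = B" unfolding B_def using pick by (intro prod.cong) auto
    finally have 2: "(\<Prod>x\<in>Ix. of_nat t + complex_of_real (rho x)) = poly q (of_nat t) * B"
      using prod.subset_diff[OF sub finite_Ix, of "\<lambda>x. of_nat t + complex_of_real (rho x)"]
      by (simp add: q_def I'_def poly_prod add.commute)
    have "poly p (of_nat n) * fps_nth (G b') n * B = poly q (of_nat t) * fps_nth (G b') t * B"
      using G_recurrence[OF b', of t] unfolding 1 2 n by (simp only: ac_simps)
    thus ?thesis using False \<open>B \<noteq> 0\<close> by (simp add: t_def)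
  qed
  moreover have "degree p = card good" "coeff p (card good) = 1"
    unfolding p_def by (rule degree_prod_monic_linear coeff_prod_monic_linear)+
  moreover have "degree q = card good" "coeff q (card good) = 1"
    unfolding q_def cI[symmetric] by (rule degree_prod_monic_linear coeff_prod_monic_linear)+
  ultimately show ?thesis by (intro exI[of _ p] exI[of _ q]) simp
qed

text \<open>The recurrence is the same for all b', so one operator serves every series. Both
  polynomials being monic, its top coefficient is \<lambda>^r (1 - \<lambda>^N), which is not
  zero.\<close>

lemma annihilating_operator:
  "\<exists>c :: nat \<Rightarrow> ratfun. c (card good) \<noteq> 0 \<and>
     (\<forall>b'\<in>BC. (\<Sum>i\<le>card good. rat_to_fls (c i) * fps_to_fls ((fps_deriv ^^ i) (G b'))) = 0)"
proof -
  let ?r = "card good"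
  obtain p q where pq: "degree p = ?r" "coeff p ?r = 1" "degree q = ?r" "coeff q ?r = 1"
    and rec: "\<And>b' n. b' \<in> BC \<Longrightarrow> poly p (of_nat n) * fps_nth (G b') n
        = (if n < N then 0 else poly q (of_nat (n - N)) * fps_nth (G b') (n - N))"
    using reduced_recurrence by blast
  obtain c where c: "c ?r = lam ^ ?r * (constR (coeff p ?r) - constR (coeff q ?r) * lam ^ N)"
    and sol: "\<And>G. (\<And>n. poly p (of_nat n) * fps_nth G n
            = (if n < N then 0 else poly q (of_nat (n - N)) * fps_nth G (n - N))) \<Longrightarrow>
      (\<Sum>i\<le>?r. rat_to_fls (c i) * fps_to_fls ((fps_deriv ^^ i) G)) = 0"
    using hypergeometric_operator[of p ?r q N] pq by auto
  have "c ?r \<noteq> 0" unfolding c using pq lam_neq_0 lam_power_neq_1[OF N_pos] by simp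
  thus ?thesis using sol[OF rec] by blast
qed

lemma operator_kills_monom:
  assumes "\<And>b'. b' \<in> BC \<Longrightarrow> (\<Sum>i\<le>r. rat_to_fls (c i) * fps_to_fls ((fps_deriv ^^ i) (G b'))) = 0"
  shows "(\<lambda>u. \<Sum>i\<le>r. c i * (Dlam a0 l ^^ i) (monom b) u) \<in> DiImage a a0 m l MC"
proof (rule DiImage_criterion)
  have D: "(\<lambda>u. c i * (Dlam a0 l ^^ i) (monom b) u) \<in> Sk MC" for i
    by (intro Sk_scale Dlam_pow_in_Sk Sk_monom b_props)
  show "(\<lambda>u. \<Sum>i\<le>r. c i * (Dlam a0 l ^^ i) (monom b) u) \<in> Sk MC" by (intro Sk_sum D)
  fix b' assume b': "b' \<in> BC"
  have "phi b' (\<lambda>u. \<Sum>i\<le>r. c i * (Dlam a0 l ^^ i) (monom b) u)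
      = (\<Sum>i\<le>r. phi b' (\<lambda>u. c i * (Dlam a0 l ^^ i) (monom b) u))"
    using D by (intro phi_sum) (auto simp: Sk_def)
  thus "phi b' (\<lambda>u. \<Sum>i\<le>r. c i * (Dlam a0 l ^^ i) (monom b) u) = 0"
    using assms[OF b'] by (simp add: phi_scale phi_Dlam_pow_monom[OF b_props(4)])
qed

end

theorem theorem8p2:
  fixes a :: "nat \<Rightarrow> int ^ 'n" and a0 :: "int ^ 'n" and m :: nat
    and l :: "nat \<Rightarrow> int" and Ck :: "(int ^ 'n) set" and b :: "int ^ 'n"
  assumes inj: "inj_on a {1..m}"
    and indep: "independent (rvec ` a ` {1..m})"
    and lpos: "\<forall>j\<in>{0..m}. 0 < l j"
    and lgcd: "Gcd (l ` {0..m}) = 1"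
    and rel: "l 0 *s a0 = (\<Sum>j\<in>{1..m}. l j *s a j)"
    and lsum: "l 0 = (\<Sum>j\<in>{1..m}. l j)"
    and coset: "is_coset a a0 m Ck"
    and b: "b \<in> Bset a m \<inter> Ck"
  shows "\<exists>r::nat. \<exists>c::nat \<Rightarrow> ratfun.
           c r \<noteq> 0 \<and>
           \<comment> \<open>L = \<Sum>_{i\<le>r} c_i \<partial>_\<lambda>^i annihilates x^b in W'_k\<close>
           (\<lambda>u. \<Sum>i\<le>r. c i * ((Dlam a0 l ^^ i) (monom b) u))
              \<in> DiImage a a0 m l (Mset a m \<inter> Ck) \<and>
           \<comment> \<open>every G^(b')_b solves L\<close>
           (\<forall>b'\<in>Bset a m \<inter> Ck.
              (\<Sum>i\<le>r. rat_to_fls (c i) * fps_to_fls ((fps_deriv ^^ i) (Gser a a0 m l b' b))) = 0) \<and>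
           \<comment> \<open>the nonzero ones are linearly independent and form a full solution system\<close>
           card {b'\<in>Bset a m \<inter> Ck. Gser a a0 m l b' b \<noteq> 0} = r \<and>
           (\<forall>w::int ^ 'n \<Rightarrow> complex.
              (\<Sum>b'\<in>{b'\<in>Bset a m \<inter> Ck. Gser a a0 m l b' b \<noteq> 0}. fps_const (w b') * Gser a a0 m l b' b) = 0
              \<longrightarrow> (\<forall>b'\<in>{b'\<in>Bset a m \<inter> Ck. Gser a a0 m l b' b \<noteq> 0}. w b' = 0))"
proof -
  interpret lattice_coset a a0 m l Ck by unfold_locales (fact assms)+
  interpret lattice_coset_point a a0 m l Ck b by unfold_locales (use b in \<open>simp add: BC_def\<close>)
  obtain c where c: "c (card good) \<noteq> 0" and sol: "\<And>b'. b' \<in> BC \<Longrightarrow>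
      (\<Sum>i\<le>card good. rat_to_fls (c i) * fps_to_fls ((fps_deriv ^^ i) (G b'))) = 0"
    using annihilating_operator by blast
  show ?thesis
    using c sol operator_kills_monom[OF sol] card_G_nonzero G_independent
    unfolding BC_def MC_def by (intro exI[of _ "card good"] exI[of _ c]) auto
qed

end
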